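(* In the setting described in the context, for any vector $\boldsymbol{c}=(c_1,c_2)$ of positive integers, for every $x_1,x_2\in\mathbb{Z}_+$ with $x_1=0$ or $x_2=0$, for every $l_1,l_2\in\mathbb{Z}_+$ with $l_1=0$ or $l_2=0$, and for every $j,j'\in S_0$, $$\lim_{k\to\infty}\frac1k\log\tilde q_{(x_1,x_2,j),(c_1k+l_1,c_2k+l_2,j')}=-\sup_{\boldsymbol\theta\in\Gamma}\langle\boldsymbol{c},\boldsymbol\theta\rangle .$$
   Context: Let $S_0=\{1,\dots,s_0\}$ be finite and $\{\boldsymbol{Y}_n\}$ a Markov chain on $\mathbb{S}=\mathbb{Z}^2\times S_0$ with $\mathbb{P}(\boldsymbol{Y}_{n+1}=(x_1+k,x_2+l,j')\mid\boldsymbol{Y}_n=(x_1,x_2,j))=[A_{k,l}]_{j,j'}$ for $k,l\in\{-1,0,1\}$ (no other transitions), $A_{k,l}$ nonnegative $s_0\times s_0$ with $\sum A_{k,l}$ stochastic. Let $\mathbb{S}_+=\mathbb{Z}_+^2\times S_0$, $P_+$ the restriction of the transition matrix to $\mathbb{S}_+$, $\tau=\inf\{n\ge0:\boldsymbol{Y}_n\notin\mathbb{S}_+\}$, $\tilde q_{\boldsymbol{y},\boldsymbol{y}'}=\mathbb{E}\big(\sum_{n=0}^{\tau-1}1(\boldsymbol{Y}_n=\boldsymbol{y}')\mid\boldsymbol{Y}_0=\boldsymbol{y}\big)$ (expected number of visits to $\boldsymbol y'$ before leaving $\mathbb{S}_+$). With $\boldsymbol\pi_{*,*}$ the stationary distribution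 of $\sum A_{k,l}$, $a_1=\boldsymbol{\pi}_{*,*}\sum_l(A_{1,l}-A_{-1,l})\mathbf{1}$, $a_2=\boldsymbol{\pi}_{*,*}\sum_k(A_{k,1}-A_{k,-1})\mathbf{1}$. Standing assumptions: $\{\boldsymbol Y_n\}$ irreducible and aperiodic; $a_1<0$ or $a_2<0$; $P_+$ irreducible. $\Gamma=\{(\theta_1,\theta_2)\in\mathbb{R}^2:\mathrm{spr}(\sum_{k,l}e^{k\theta_1+l\theta_2}A_{k,l})<1\}$ (spr = spectral radius); $\langle\cdot,\cdot\rangle$ is the Euclidean inner product. *)

theory Defs
  imports Complex_Main "Jordan_Normal_Form.Spectral_Radius"
begin

text \<open>Setting: phase space S0 = {0..<s0} (relabelling of {1..s0}); the blocks are
  A k l i j = [A_{k,l}]_{i,j} for k,l in {-1,0,1}; states are (x1,x2,j) :: int * int * nat.\<close>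

type_synonym state = "int \<times> int \<times> nat"

definition steps :: "int set" where "steps = {-1, 0, 1}"

definition qbd_blocks :: "nat \<Rightarrow> (int \<Rightarrow> int \<Rightarrow> nat \<Rightarrow> nat \<Rightarrow> real) \<Rightarrow> bool" where
  "qbd_blocks s0 A \<longleftrightarrow> s0 \<ge> 1
     \<and> (\<forall>k l i j. A k l i j \<ge> 0)
     \<and> (\<forall>k l i j. (k \<notin> steps \<or> l \<notin> steps \<or> i \<ge> s0 \<or> j \<ge> s0) \<longrightarrow> A k l i j = 0)
     \<and> (\<forall>i<s0. (\<Sum>k\<in>steps. \<Sum>l\<in>steps. \<Sum>j<s0. A k l i j) = 1)"

text \<open>Whole state space S and nonnegative part S_+.\<close>
definition Sfull :: "nat \<Rightarrow> state set" where
  "Sfull s0 = {(x1, x2, j). j < s0}"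

definition Splus :: "nat \<Rightarrow> state set" where
  "Splus s0 = {(x1, x2, j). x1 \<ge> 0 \<and> x2 \<ge> 0 \<and> j < s0}"

text \<open>n-step transition probabilities P^n(y,y') of the full chain.\<close>
fun pstep :: "nat \<Rightarrow> nat \<Rightarrow> (int \<Rightarrow> int \<Rightarrow> nat \<Rightarrow> nat \<Rightarrow> real) \<Rightarrow> state \<Rightarrow> state \<Rightarrow> real" where
  "pstep s0 0 A y y' = (if y = y' then 1 else 0)"
| "pstep s0 (Suc n) A (x1, x2, j) y' =
     (\<Sum>k\<in>steps. \<Sum>l\<in>steps. \<Sum>i<s0. A k l j i * pstep s0 n A (x1 + k, x2 + l, i) y')"

text \<open>n-step taboo probabilities (P_+)^n(y,y'): the entries of the n-th power of the restriction
  P_+ of the transition matrix to S_+, i.e. P(Y_n = y', Y_0,...,Y_n \<in> S_+ | Y_0 = y).\<close>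
fun pplus :: "nat \<Rightarrow> nat \<Rightarrow> (int \<Rightarrow> int \<Rightarrow> nat \<Rightarrow> nat \<Rightarrow> real) \<Rightarrow> state \<Rightarrow> state \<Rightarrow> real" where
  "pplus s0 0 A y y' = (if y = y' \<and> y \<in> Splus s0 then 1 else 0)"
| "pplus s0 (Suc n) A (x1, x2, j) y' =
     (if (x1, x2, j) \<in> Splus s0 then
        (\<Sum>k\<in>steps. \<Sum>l\<in>steps. \<Sum>i<s0. A k l j i * pplus s0 n A (x1 + k, x2 + l, i) y')
      else 0)"

text \<open>q~_{y,y'} = E(sum_{n<tau} 1(Y_n = y') | Y_0 = y) = sum_n P(Y_n = y', n < tau | Y_0 = y)
  = sum_n (P_+^n)_{y,y'}.\<close>
definition qtilde :: "nat \<Rightarrow> (int \<Rightarrow> int \<Rightarrow> nat \<Rightarrow> nat \<Rightarrow> real) \<Rightarrow> state \<Rightarrow> state \<Rightarrow> real" where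
  "qtilde s0 A y y' = (\<Sum>n. pplus s0 n A y y')"

definition chain_irreducible :: "nat \<Rightarrow> (int \<Rightarrow> int \<Rightarrow> nat \<Rightarrow> nat \<Rightarrow> real) \<Rightarrow> bool" where
  "chain_irreducible s0 A \<longleftrightarrow> (\<forall>y\<in>Sfull s0. \<forall>y'\<in>Sfull s0. \<exists>n. pstep s0 n A y y' > 0)"

definition chain_aperiodic :: "nat \<Rightarrow> (int \<Rightarrow> int \<Rightarrow> nat \<Rightarrow> nat \<Rightarrow> real) \<Rightarrow> bool" where
  "chain_aperiodic s0 A \<longleftrightarrow> (\<forall>y\<in>Sfull s0. Gcd {n. n > 0 \<and> pstep s0 n A y y > 0} = 1)"

definition Pplus_irreducible :: "nat \<Rightarrow> (int \<Rightarrow> int \<Rightarrow> nat \<Rightarrow> nat \<Rightarrow> real) \<Rightarrow> bool" where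
  "Pplus_irreducible s0 A \<longleftrightarrow> (\<forall>y\<in>Splus s0. \<forall>y'\<in>Splus s0. \<exists>n. pplus s0 n A y y' > 0)"

text \<open>A_{*,*} = sum_{k,l} A_{k,l} and its stationary distribution.\<close>
definition Astar :: "(int \<Rightarrow> int \<Rightarrow> nat \<Rightarrow> nat \<Rightarrow> real) \<Rightarrow> nat \<Rightarrow> nat \<Rightarrow> real" where
  "Astar A i j = (\<Sum>k\<in>steps. \<Sum>l\<in>steps. A k l i j)"

definition stationary :: "nat \<Rightarrow> (int \<Rightarrow> int \<Rightarrow> nat \<Rightarrow> nat \<Rightarrow> real) \<Rightarrow> (nat \<Rightarrow> real) \<Rightarrow> bool" where
  "stationary s0 A p \<longleftrightarrow> (\<forall>i<s0. p i \<ge> 0) \<and> (\<Sum>i<s0. p i) = 1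
     \<and> (\<forall>j<s0. (\<Sum>i<s0. p i * Astar A i j) = p j)"

text \<open>a_1 = p sum_l (A_{1,l} - A_{-1,l}) 1,  a_2 = p sum_k (A_{k,1} - A_{k,-1}) 1.\<close>
definition drift1 :: "nat \<Rightarrow> (int \<Rightarrow> int \<Rightarrow> nat \<Rightarrow> nat \<Rightarrow> real) \<Rightarrow> (nat \<Rightarrow> real) \<Rightarrow> real" where
  "drift1 s0 A p = (\<Sum>i<s0. p i * (\<Sum>l\<in>steps. \<Sum>j<s0. A 1 l i j - A (-1) l i j))"

definition drift2 :: "nat \<Rightarrow> (int \<Rightarrow> int \<Rightarrow> nat \<Rightarrow> nat \<Rightarrow> real) \<Rightarrow> (nat \<Rightarrow> real) \<Rightarrow> real" where
  "drift2 s0 A p = (\<Sum>i<s0. p i * (\<Sum>k\<in>steps. \<Sum>j<s0. A k 1 i j - A k (-1) i j))"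

text \<open>A_{*,*}(theta) = sum_{k,l} e^{k theta1 + l theta2} A_{k,l}, as a complex s0 x s0 matrix.\<close>
definition Atheta :: "nat \<Rightarrow> (int \<Rightarrow> int \<Rightarrow> nat \<Rightarrow> nat \<Rightarrow> real) \<Rightarrow> real \<times> real \<Rightarrow> complex mat" where
  "Atheta s0 A \<theta> = mat s0 s0 (\<lambda>(i, j). complex_of_real
      (\<Sum>k\<in>steps. \<Sum>l\<in>steps. exp (real_of_int k * fst \<theta> + real_of_int l * snd \<theta>) * A k l i j))"

definition Gamma :: "nat \<Rightarrow> (int \<Rightarrow> int \<Rightarrow> nat \<Rightarrow> nat \<Rightarrow> real) \<Rightarrow> (real \<times> real) set" where
  "Gamma s0 A = {\<theta>. spectral_radius (Atheta s0 A \<theta>) < 1}"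

end

theory Submission
  imports Defs
begin

text \<open>Upper bound: the tilted matrix \<open>A(\<theta>)\<close> has geometrically decaying powers for \<open>\<theta>\<close> in Gamma,
  so the expected number of visits to \<open>y\<close> is at most \<open>C exp (- \<langle>\<theta>, y\<rangle>)\<close>. Gamma is nonempty because
  the drift does not vanish.

  Lower bound: let \<open>h(d)\<close> be the infimum of \<open>- ln (P\<^sup>n((0,j), (kd,j))) / k\<close> over \<open>k\<close> and \<open>n\<close>.
  Concatenation of cycles makes \<open>h\<close> sublinear on the lattice, so a supporting functional
  \<open>\<theta> \<le> h\<close> with \<open>\<langle>\<theta>, c\<rangle> = h(c)\<close> exists. As the paths of length \<open>n\<close> reach only \<open>O(n\<^sup>2)\<close> sites, the
  bounds \<open>P\<^sup>n((0,j), (d,j)) \<le> exp (- \<langle>\<theta>, d\<rangle>)\<close> place \<open>\<theta>\<close> in the closure of Gamma, and \<open>h(c)\<close> is at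
  most the supremum. A nearly optimal cycle with displacement \<open>m c\<close> stays in the quadrant when it
  starts far enough from the axes, and it can be repeated there indefinitely.\<close>

subsection \<open>Powers of nonnegative matrices\<close>

text \<open>Real powers that peel off the first factor, in parallel to the first-step recursions of
  \<open>pstep\<close> and \<open>pplus\<close>.\<close>

fun mpow :: "nat \<Rightarrow> (nat \<Rightarrow> nat \<Rightarrow> real) \<Rightarrow> nat \<Rightarrow> nat \<Rightarrow> nat \<Rightarrow> real" where
  "mpow s M 0 i j = (if i = j then 1 else 0)"
| "mpow s M (Suc n) i j = (\<Sum>m<s. M i m * mpow s M n m j)"

abbreviation cmat :: "nat \<Rightarrow> (nat \<Rightarrow> nat \<Rightarrow> real) \<Rightarrow> complex mat" where
  "cmat s M \<equiv> mat s s (\<lambda>(i, j). complex_of_real (M i j))"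

lemma mpow_nonneg:
  assumes "\<And>i j. 0 \<le> M i j"
  shows "0 \<le> mpow s M n i j"
  by (induction n arbitrary: i) (auto intro!: sum_nonneg mult_nonneg_nonneg assms)

lemma mpow_mult_le:
  assumes "\<And>i j. 0 \<le> M i j"
  shows "mpow s M n i l * mpow s M m l j \<le> mpow s M (n + m) i j"
proof (induction n arbitrary: i)
  case 0
  then show ?case by (simp add: mpow_nonneg assms)
next
  case (Suc n)
  have "mpow s M (Suc n) i l * mpow s M m l j
      = (\<Sum>k<s. M i k * (mpow s M n k l * mpow s M m l j))"
    by (simp add: sum_distrib_right mult.assoc)
  also have "\<dots> \<le> (\<Sum>k<s. M i k * mpow s M (n + m) k j)"
    by (intro sum_mono mult_left_mono Suc assms)
  finally show ?case by simp
qed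

lemma mpow_diag_power_le:
  assumes "\<And>i j. 0 \<le> M i j"
  shows "mpow s M n i i ^ k \<le> mpow s M (k * n) i i"
proof (induction k)
  case (Suc k)
  have "mpow s M n i i ^ Suc k \<le> mpow s M n i i * mpow s M (k * n) i i"
    using Suc by (simp add: mult_left_mono mpow_nonneg assms)
  also have "\<dots> \<le> mpow s M (n + k * n) i i"
    by (rule mpow_mult_le[OF assms])
  finally show ?case by simp
qed simp

text \<open>Matrix powers \<open>^\<^sub>m\<close> peel off the last factor, so the two recursions
  have to be reconciled before \<open>cmat_power\<close>.\<close>

lemma mpow_Suc_right:
  assumes "i < s" "j < s"
  shows "mpow s M (Suc n) i j = (\<Sum>m<s. mpow s M n i m * M m j)"
  using assms(1)
proof (induction n arbitrary: i)
  case 0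
  then show ?case
    using assms by (simp add: if_distrib[of "\<lambda>x. x * _"] if_distrib[of "\<lambda>x. _ * x"] cong: if_cong)
next
  case (Suc n)
  have "mpow s M (Suc (Suc n)) i j = (\<Sum>m<s. M i m * mpow s M (Suc n) m j)" by simp
  also have "\<dots> = (\<Sum>m<s. M i m * (\<Sum>l<s. mpow s M n m l * M l j))"
    by (intro sum.cong refl) (simp only: lessThan_iff Suc.IH)
  also have "\<dots> = (\<Sum>m<s. \<Sum>l<s. M i m * mpow s M n m l * M l j)"
    by (simp add: sum_distrib_left mult.assoc)
  also have "\<dots> = (\<Sum>l<s. \<Sum>m<s. M i m * mpow s M n m l * M l j)"
    by (rule sum.swap)
  finally show ?case by (simp add: sum_distrib_right)
qed

lemma cmat_power:
  assumes "i < s" "j < s"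
  shows "(cmat s M ^\<^sub>m n) $$ (i, j) = complex_of_real (mpow s M n i j)"
  using assms
proof (induction n arbitrary: i j)
  case (Suc n)
  have "(cmat s M ^\<^sub>m Suc n) $$ (i, j)
      = (\<Sum>m<s. (cmat s M ^\<^sub>m n) $$ (i, m) * cmat s M $$ (m, j))"
    using Suc.prems by (simp add: scalar_prod_def lessThan_atLeast0)
  also have "\<dots> = complex_of_real (\<Sum>m<s. mpow s M n i m * M m j)"
    using Suc by simp
  finally show ?case using mpow_Suc_right[OF Suc.prems] by simp
qed simp

text \<open>An eigenvector of \<open>M / r\<close> for \<open>e\<close> is one of \<open>M\<close>
  for \<open>r * e\<close>; this is applied to an eigenvalue of maximal modulus.\<close>

lemma spectral_radius_smult_less_1:
  assumes M: "M \<in> carrier_mat s s" and s: "s > 0"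
    and sr: "spectral_radius M < r" and r: "0 < r"
  shows "spectral_radius (complex_of_real (1 / r) \<cdot>\<^sub>m M) < 1"
proof -
  let ?N = "complex_of_real (1 / r) \<cdot>\<^sub>m M"
  have N: "?N \<in> carrier_mat s s" using M by simp
  obtain e where e: "e \<in> spectrum ?N" and se: "spectral_radius ?N = norm e"
    using spectral_radius_mem_max(1)[OF N s] by auto
  obtain v where v: "eigenvector ?N v e"
    using e by (auto simp: spectrum_def eigenvalue_def)
  have vc: "v \<in> carrier_vec s" and v0: "v \<noteq> 0\<^sub>v s" and ve: "?N *\<^sub>v v = e \<cdot>\<^sub>v v"
    using v M by (auto simp: eigenvector_def)
  have "M *\<^sub>v v = (complex_of_real r * e) \<cdot>\<^sub>v v"
  proof (rule eq_vecI)
    fix i assume i: "i < dim_vec ((complex_of_real r * e) \<cdot>\<^sub>v v)"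
    then have i: "i < s" using vc by simp
    have "(?N *\<^sub>v v) $ i = complex_of_real (1 / r) * (M *\<^sub>v v) $ i"
      using i M vc by (simp add: scalar_prod_def sum_distrib_left mult.assoc)
    then have "complex_of_real (1 / r) * (M *\<^sub>v v) $ i = e * v $ i"
      using ve i vc by simp
    then show "(M *\<^sub>v v) $ i = ((complex_of_real r * e) \<cdot>\<^sub>v v) $ i"
      using i r vc by (simp add: field_simps)
  qed (use M vc in auto)
  then have "complex_of_real r * e \<in> spectrum M"
    using vc v0 M by (auto simp: spectrum_def eigenvalue_def eigenvector_def)
  then have "norm (complex_of_real r * e) \<le> spectral_radius M"
    by (intro spectral_radius_mem_max(2)[OF M s] imageI)
  then have "r * norm e \<le> spectral_radius M" using r by (simp add: norm_mult)
  then have "r * norm e < r * 1" using sr by linarith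
  then show ?thesis using r se by (simp only: mult_less_cancel_left_pos)
qed

text \<open>After division by an \<open>r\<close> between the spectral radius and 1 the spectral
  radius is still below 1, so the Jordan normal form bounds all powers of the scaled matrix
  uniformly.\<close>

lemma mpow_geometric_bound:
  assumes nn: "\<And>i j. 0 \<le> M i j" and s: "s > 0" and sr: "spectral_radius (cmat s M) < 1"
  obtains C r where "0 < r" "r < 1" "0 < C"
    "\<And>n i j. i < s \<Longrightarrow> j < s \<Longrightarrow> mpow s M n i j \<le> C * r ^ n"
proof -
  \<comment> \<open>The midpoint between the spectral radius and 1; \<open>max 0\<close> secures
    \<open>0 < r\<close>.\<close>
  define r where "r = (max 0 (spectral_radius (cmat s M)) + 1) / 2"
  have r: "0 < r" "r < 1" "spectral_radius (cmat s M) < r"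
    using sr by (auto simp: r_def max_def)
  let ?N = "cmat s (\<lambda>i j. M i j / r)"
  have "complex_of_real (1 / r) \<cdot>\<^sub>m cmat s M = ?N"
    by (rule eq_matI) auto
  then have "spectral_radius ?N < 1"
    using spectral_radius_smult_less_1[OF _ s r(3) r(1)] by simp
  then obtain c where c: "\<And>k. norm_bound (?N ^\<^sub>m k) c"
    using spectral_radius_jnf_norm_bound_less_1_upper_triangular[of ?N s] by auto
  have scale: "mpow s M n i j = r ^ n * mpow s (\<lambda>i j. M i j / r) n i j" for n i j
    using r(1) by (induction n arbitrary: i) (auto simp: sum_distrib_left mult_ac intro!: sum.cong)
  have "mpow s M n i j \<le> max 1 c * r ^ n" if "i < s" "j < s" for n i j
  proof -
    have "norm ((?N ^\<^sub>m n) $$ (i, j)) \<le> c"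
      using c[of n] that by (auto simp: norm_bound_def)
    then have "\<bar>mpow s (\<lambda>i j. M i j / r) n i j\<bar> \<le> c"
      by (simp only: cmat_power[OF that] norm_of_real)
    then have "mpow s (\<lambda>i j. M i j / r) n i j \<le> max 1 c" by linarith
    then show ?thesis
      using r(1) unfolding scale[of n i j] by (simp add: mult.commute mult_right_mono)
  qed
  then show ?thesis using r by (intro that[of r "max 1 c"]) auto
qed

text \<open>An eigenvalue \<open>e\<close> of modulus at least 1 with eigenvector \<open>v\<close>
  gives \<open>e ^ n * v\<close>, which does not vanish in the limit at a coordinate where
  \<open>v\<close> is nonzero.\<close>

lemma spectral_radius_less_1_if_mpow_tendsto_0:
  assumes s: "s > 0"
    and lim: "\<And>i j. i < s \<Longrightarrow> j < s \<Longrightarrow> (\<lambda>n. mpow s M n i j) \<longlonglongrightarrow> 0"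
  shows "spectral_radius (cmat s M) < 1"
proof (rule ccontr)
  assume "\<not> ?thesis"
  moreover have cm: "cmat s M \<in> carrier_mat s s" by simp
  ultimately obtain e where e: "e \<in> spectrum (cmat s M)" and e1: "norm e \<ge> 1"
    using spectral_radius_mem_max(1)[OF cm s] by auto
  obtain v where v: "eigenvector (cmat s M) v e"
    using e by (auto simp: spectrum_def eigenvalue_def)
  have vc: "v \<in> carrier_vec s" and v0: "v \<noteq> 0\<^sub>v s"
    using v by (auto simp: eigenvector_def)
  obtain i where i: "i < s" "v $ i \<noteq> 0"
    using v0 vc by (metis carrier_vecD eq_vecI index_zero_vec)
  have pw: "(\<Sum>j<s. complex_of_real (mpow s M n i j) * v $ j) = e ^ n * v $ i" for n
  proof -
    have "(cmat s M ^\<^sub>m n *\<^sub>v v) $ i = (e ^ n \<cdot>\<^sub>v v) $ i"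
      using eigenvector_pow[OF cm v] by simp
    moreover have "(cmat s M ^\<^sub>m n *\<^sub>v v) $ i
        = (\<Sum>j<s. (cmat s M ^\<^sub>m n) $$ (i, j) * v $ j)"
      using i vc by (simp add: scalar_prod_def lessThan_atLeast0 mult_mat_vec_def)
    ultimately show ?thesis using i vc by (simp add: cmat_power)
  qed
  have "(\<lambda>n. \<Sum>j<s. complex_of_real (mpow s M n i j) * v $ j)
      \<longlonglongrightarrow> (\<Sum>j<s. complex_of_real 0 * v $ j)"
    by (intro tendsto_intros lim i) auto
  then have "(\<lambda>n. norm (e ^ n * v $ i)) \<longlonglongrightarrow> 0"
    by (simp add: pw tendsto_norm_zero)
  moreover have "norm (v $ i) \<le> norm (e ^ n * v $ i)" for n
    using one_le_power[OF e1, of n] by (simp add: norm_mult norm_power mult_le_cancel_right1)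
  ultimately have "norm (v $ i) \<le> 0"
    by (intro LIMSEQ_le_const[of _ 0]) auto
  then show False using i by simp
qed

text \<open>\<open>M\<close> contracts the maximum norm weighted by \<open>u\<close>: finitely many
  strict inequalities yield one ratio \<open>r < 1\<close>, and the powers decay like
  \<open>r ^ n\<close>.\<close>

lemma spectral_radius_less_1_if_subinvariant:
  assumes nn: "\<And>i j. 0 \<le> M i j" and s: "s > 0"
    and u: "\<And>i. i < s \<Longrightarrow> 0 < u i"
    and sub: "\<And>i. i < s \<Longrightarrow> (\<Sum>j<s. M i j * u j) < u i"
  shows "spectral_radius (cmat s M) < 1"
proof (rule spectral_radius_less_1_if_mpow_tendsto_0[OF s])
  define r where "r = Max ((\<lambda>i. (\<Sum>j<s. M i j * u j) / u i) ` {..<s})"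
  have r_ge: "(\<Sum>j<s. M i j * u j) \<le> r * u i" if "i < s" for i
  proof -
    have "(\<Sum>j<s. M i j * u j) / u i \<le> r"
      unfolding r_def using that by (intro Max_ge) auto
    then show ?thesis using u[OF that] by (simp add: field_simps)
  qed
  have "r \<in> (\<lambda>i. (\<Sum>j<s. M i j * u j) / u i) ` {..<s}"
    unfolding r_def using s by (intro Max_in) auto
  then have r1: "r < 1" and r0: "0 \<le> r"
    using sub u by (auto simp: field_simps less_imp_le intro!: divide_nonneg_pos sum_nonneg mult_nonneg_nonneg nn)
  have pow: "(\<Sum>j<s. mpow s M n i j * u j) \<le> r ^ n * u i" if "i < s" for n i
    using that
  proof (induction n arbitrary: i)
    case 0
    then show ?case by (simp add: if_distrib[of "\<lambda>x. x * _"] cong: if_cong)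
  next
    case (Suc n)
    have "(\<Sum>j<s. mpow s M (Suc n) i j * u j) = (\<Sum>j<s. \<Sum>m<s. M i m * (mpow s M n m j * u j))"
      by (simp add: sum_distrib_right mult.assoc)
    also have "\<dots> = (\<Sum>m<s. M i m * (\<Sum>j<s. mpow s M n m j * u j))"
      by (subst sum.swap) (simp add: sum_distrib_left)
    also have "\<dots> \<le> (\<Sum>m<s. M i m * (r ^ n * u m))"
      by (intro sum_mono mult_left_mono Suc.IH nn) auto
    also have "\<dots> = r ^ n * (\<Sum>m<s. M i m * u m)"
      by (simp add: sum_distrib_left mult_ac)
    also have "\<dots> \<le> r ^ n * (r * u i)"
      using r0 by (intro mult_left_mono r_ge Suc.prems) auto
    finally show ?case by (simp add: mult_ac)
  qed
  fix i j assume ij: "i < s" "j < s"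
  have le: "mpow s M n i j \<le> r ^ n * (u i / u j)" for n
  proof -
    have "mpow s M n i j * u j \<le> (\<Sum>j<s. mpow s M n i j * u j)"
      using ij u by (intro member_le_sum) (auto intro!: mult_nonneg_nonneg mpow_nonneg nn intro: less_imp_le)
    then show ?thesis using pow[OF ij(1), of n] u[OF ij(2)] by (simp add: field_simps)
  qed
  have "(\<lambda>n. r ^ n * (u i / u j)) \<longlonglongrightarrow> 0 * (u i / u j)"
    by (intro tendsto_intros LIMSEQ_power_zero) (use r0 r1 in auto)
  then show "(\<lambda>n. mpow s M n i j) \<longlonglongrightarrow> 0"
    using le by (intro tendsto_sandwich[of "\<lambda>_. 0" "\<lambda>n. mpow s M n i j" sequentially "\<lambda>n. r ^ n * (u i / u j)" 0])
      (auto intro!: always_eventually mpow_nonneg nn)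
qed

subsection \<open>The drift and the spectral radius\<close>

text \<open>A Doeblin estimate: every row puts mass at least \<open>d\<close> on state 0, which
  pulls all averages towards \<open>g 0\<close>. The two bounds together shrink the range by the
  factor \<open>1 - d\<close>.\<close>

lemma oscillation_contraction:
  fixes K :: "nat \<Rightarrow> nat \<Rightarrow> real"
  assumes nn: "\<And>i j. 0 \<le> K i j" and row: "\<And>i. i < s \<Longrightarrow> (\<Sum>j<s. K i j) = 1"
    and s: "0 < s" and d: "\<And>i. i < s \<Longrightarrow> d \<le> K i 0"
    and g: "\<And>i. i < s \<Longrightarrow> a \<le> g i \<and> g i \<le> b" and i: "i < s"
  shows "a + d * (g 0 - a) \<le> (\<Sum>j<s. K i j * g j) \<and> (\<Sum>j<s. K i j * g j) \<le> b - d * (b - g 0)"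
proof -
  have "K i 0 * (b - g 0) \<le> (\<Sum>j<s. K i j * (b - g j))"
    using s g by (intro member_le_sum) (auto intro!: mult_nonneg_nonneg nn)
  moreover have "d * (b - g 0) \<le> K i 0 * (b - g 0)"
    using d[OF i] g[OF s] by (intro mult_right_mono) auto
  moreover have "(\<Sum>j<s. K i j * (b - g j)) = b - (\<Sum>j<s. K i j * g j)"
    using row[OF i] by (simp add: algebra_simps sum_subtractf flip: sum_distrib_left)
  moreover have "K i 0 * (g 0 - a) \<le> (\<Sum>j<s. K i j * (g j - a))"
    using s g by (intro member_le_sum) (auto intro!: mult_nonneg_nonneg nn)
  moreover have "d * (g 0 - a) \<le> K i 0 * (g 0 - a)"
    using d[OF i] g[OF s] by (intro mult_right_mono) auto
  moreover have "(\<Sum>j<s. K i j * (g j - a)) = (\<Sum>j<s. K i j * g j) - a"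
    using row[OF i] by (simp add: algebra_simps sum_subtractf flip: sum_distrib_left)
  ultimately show ?thesis by linarith
qed

text \<open>The lazy chain can wait at its starting state, so paths to 0 of different lengths can
  all be padded to the maximal length \<open>N\<close>.\<close>

lemma lazy_power_positive:
  assumes nn: "\<And>i j. 0 \<le> M i j" and s: "0 < s"
    and irr: "\<And>i. i < s \<Longrightarrow> \<exists>n. 0 < mpow s M n i 0"
  defines "L \<equiv> (\<lambda>i j. ((if i = j then 1 else 0) + M i j) / 2)"
  shows "\<exists>N d. 0 < d \<and> (\<forall>i<s. d \<le> mpow s L N i 0)"
proof -
  have Lnn: "0 \<le> L i j" for i j using nn[of i j] by (simp add: L_def)
  have ge: "(1 / 2) ^ n * mpow s M n i j \<le> mpow s L n i j" for n i j
  proof (induction n arbitrary: i)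
    case (Suc n)
    have "(1 / 2) ^ Suc n * mpow s M (Suc n) i j
        = (\<Sum>m<s. (M i m / 2) * ((1 / 2) ^ n * mpow s M n m j))"
      by (simp add: sum_distrib_left mult_ac)
    also have "\<dots> \<le> (\<Sum>m<s. L i m * mpow s L n m j)"
      using Suc by (intro sum_mono mult_mono) (auto simp: L_def nn intro!: mult_nonneg_nonneg mpow_nonneg)
    finally show ?case by simp
  qed simp
  have stay: "0 < mpow s L n i i" if "i < s" for n i
  proof -
    have "L i i \<le> mpow s L 1 i i"
      using that by (simp add: if_distrib[of "\<lambda>x. _ * x"] cong: if_cong)
    moreover have "0 < L i i" using nn[of i i] by (simp add: L_def)
    ultimately have "0 < mpow s L 1 i i ^ n" by simp
    then show ?thesis using mpow_diag_power_le[of L s 1 i n] Lnn by simp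
  qed
  obtain f where f: "\<And>i. i < s \<Longrightarrow> 0 < mpow s M (f i) i 0" using irr by metis
  define N where "N = Max (f ` {..<s})"
  have pos: "0 < mpow s L N i 0" if "i < s" for i
  proof -
    have "f i \<le> N" unfolding N_def using that by (intro Max_ge) auto
    then have "N = (N - f i) + f i" by simp
    moreover have "0 < (1 / 2) ^ f i * mpow s M (f i) i 0" using f[OF that] by simp
    then have "0 < mpow s L (f i) i 0" using ge[of "f i" i 0] by linarith
    ultimately show ?thesis
      using mpow_mult_le[of L s "N - f i" i i "f i" 0] Lnn stay[OF that, of "N - f i"]
      by (metis mult_pos_pos order_less_le_trans)
  qed
  define d where "d = Min ((\<lambda>i. mpow s L N i 0) ` {..<s})"
  have "d \<in> (\<lambda>i. mpow s L N i 0) ` {..<s}"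
    unfolding d_def using s by (intro Min_in) auto
  then have "0 < d" using pos by auto
  moreover have "d \<le> mpow s L N i 0" if "i < s" for i
    unfolding d_def using that by (intro Min_le) auto
  ultimately show ?thesis by blast
qed

lemma mpow_row_sum:
  assumes "\<And>i. i < s \<Longrightarrow> (\<Sum>j<s. M i j) = 1" "i < s"
  shows "(\<Sum>j<s. mpow s M n i j) = 1"
  using assms(2)
proof (induction n arbitrary: i)
  case (Suc n)
  have "(\<Sum>j<s. mpow s M (Suc n) i j) = (\<Sum>m<s. M i m * (\<Sum>j<s. mpow s M n m j))"
    by (simp add: sum_distrib_left) (rule sum.swap)
  also have "\<dots> = (\<Sum>m<s. M i m)" using Suc.IH by simp
  finally show ?case using assms(1) Suc.prems by simp
qed simp

text \<open>The functions \<open>f + M v - v\<close> form a class that is closed under the lazy chain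
  \<open>(I + M) / 2\<close>, all of whose members have the same \<open>p\<close>-mean as \<open>f\<close>. Powers of the lazy chain
  contract the oscillation, so the class contains functions that are nearly constant.\<close>

lemma poisson_strict_inequality:
  assumes nn: "\<And>i j. 0 \<le> M i j" and s: "0 < s"
    and row: "\<And>i. i < s \<Longrightarrow> (\<Sum>j<s. M i j) = 1"
    and irr: "\<And>i. i < s \<Longrightarrow> \<exists>n. 0 < mpow s M n i 0"
    and p: "\<And>i. i < s \<Longrightarrow> 0 \<le> p i" "(\<Sum>i<s. p i) = 1"
    and inv: "\<And>j. j < s \<Longrightarrow> (\<Sum>i<s. p i * M i j) = p j"
    and neg: "(\<Sum>i<s. p i * f i) < 0"
  obtains v where "\<And>i. i < s \<Longrightarrow> f i + (\<Sum>j<s. M i j * v j) - v i < 0"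
proof -
  define L where "L = (\<lambda>i j. ((if i = j then 1 else 0) + M i j) / 2)"
  obtain N d where d0: "0 < d" and dN: "\<And>i. i < s \<Longrightarrow> d \<le> mpow s L N i 0"
    using lazy_power_positive[of M s, OF nn s irr] unfolding L_def by blast
  have Lnn: "0 \<le> L i j" for i j using nn[of i j] by (simp add: L_def)
  have L_app: "(\<Sum>j<s. L i j * g j) = (g i + (\<Sum>j<s. M i j * g j)) / 2" if "i < s" for g i
    using that by (simp add: L_def add_divide_distrib sum.distrib distrib_right
        if_distrib[of "\<lambda>x. x * _"] if_distrib[of "\<lambda>x. x / _"] flip: sum_divide_distrib cong: if_cong)
  have Lrow: "(\<Sum>j<s. L i j) = 1" if "i < s" for i
    using L_app[OF that, of "\<lambda>_. 1"] row[OF that] by simp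
  define R where "R = (\<lambda>g. \<exists>v. \<forall>i<s. g i = f i + (\<Sum>j<s. M i j * v j) - v i)"
  have R_lazy: "R (\<lambda>i. \<Sum>j<s. L i j * g j)" if Rg: "R g" for g
  proof -
    obtain v where v: "\<forall>i<s. g i = f i + (\<Sum>j<s. M i j * v j) - v i"
      using Rg by (auto simp: R_def)
    \<comment> \<open>As \<open>L g - g = (M g - g) / 2\<close>, a lazy step adds
      \<open>g / 2\<close> to \<open>v\<close>.\<close>
    have "(\<Sum>j<s. L i j * g j) = f i + (\<Sum>j<s. M i j * (v j + g j / 2)) - (v i + g i / 2)"
      if i: "i < s" for i
    proof -
      have "g i = f i + (\<Sum>j<s. M i j * v j) - v i" using v i by blast
      moreover have "(\<Sum>j<s. M i j * (v j + g j / 2)) = (\<Sum>j<s. M i j * v j) + (\<Sum>j<s. M i j * g j) / 2"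
        by (simp add: distrib_left sum.distrib sum_divide_distrib)
      ultimately show ?thesis unfolding L_app[OF i] by (simp add: field_simps)
    qed
    then show ?thesis unfolding R_def by (intro exI[of _ "\<lambda>j. v j + g j / 2"]) auto
  qed
  have R_pow: "R (\<lambda>i. \<Sum>j<s. mpow s L n i j * g j)" if g: "R g" for g n
  proof (induction n)
    case 0
    obtain v where v: "\<forall>i<s. g i = f i + (\<Sum>j<s. M i j * v j) - v i"
      using g by (auto simp: R_def)
    then show ?case unfolding R_def
      by (intro exI[of _ v]) (simp add: if_distrib[of "\<lambda>x. x * _"] cong: if_cong)
  next
    case (Suc n)
    have "(\<lambda>i. \<Sum>j<s. mpow s L (Suc n) i j * g j)
        = (\<lambda>i. \<Sum>m<s. L i m * (\<Sum>j<s. mpow s L n m j * g j))"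
      by (rule ext) (simp add: sum_distrib_left sum_distrib_right mult.assoc, rule sum.swap)
    then show ?case using R_lazy[OF Suc] by simp
  qed
  have p_mean: "(\<Sum>i<s. p i * g i) = (\<Sum>i<s. p i * f i)" if Rg: "R g" for g
  proof -
    obtain v where v: "\<forall>i<s. g i = f i + (\<Sum>j<s. M i j * v j) - v i"
      using Rg by (auto simp: R_def)
    have "(\<Sum>i<s. p i * g i)
        = (\<Sum>i<s. p i * f i + (\<Sum>j<s. (p i * M i j) * v j) - p i * v i)"
      using v by (intro sum.cong refl) (simp add: distrib_left right_diff_distrib sum_distrib_left mult.assoc)
    also have "\<dots> = (\<Sum>i<s. p i * f i) + (\<Sum>i<s. \<Sum>j<s. (p i * M i j) * v j) - (\<Sum>i<s. p i * v i)"
      by (simp add: sum.distrib sum_subtractf)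
    also have "(\<Sum>i<s. \<Sum>j<s. (p i * M i j) * v j) = (\<Sum>j<s. p j * v j)"
      by (subst sum.swap) (simp add: inv flip: sum_distrib_right)
    finally show ?thesis by simp
  qed
  have d1: "d \<le> 1"
  proof -
    have "mpow s L N 0 0 \<le> (\<Sum>j<s. mpow s L N 0 j)"
      using s by (intro member_le_sum) (auto intro: mpow_nonneg Lnn)
    then show ?thesis using mpow_row_sum[of s L 0 N] Lrow dN[of 0] s by simp
  qed
  define a0 b0 where "a0 = Min (f ` {..<s})" and "b0 = Max (f ` {..<s})"
  have osc: "\<exists>g a b. R g \<and> (\<forall>i<s. a \<le> g i \<and> g i \<le> b) \<and> b - a \<le> (1 - d) ^ m * (b0 - a0)" for m
  proof (induction m)
    case 0
    have "R f" unfolding R_def by (intro exI[of _ "\<lambda>_. 0"]) simp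
    moreover have "\<forall>i<s. a0 \<le> f i \<and> f i \<le> b0" by (simp add: a0_def b0_def)
    ultimately show ?case by fastforce
  next
    case (Suc m)
    then obtain g a b where g: "R g" "\<forall>i<s. a \<le> g i \<and> g i \<le> b" "b - a \<le> (1 - d) ^ m * (b0 - a0)"
      by blast
    let ?g = "\<lambda>i. \<Sum>j<s. mpow s L N i j * g j"
    have "\<forall>i<s. a + d * (g 0 - a) \<le> ?g i \<and> ?g i \<le> b - d * (b - g 0)"
      by (intro allI impI oscillation_contraction[where K = "mpow s L N"] mpow_nonneg mpow_row_sum Lnn Lrow dN s)
        (use g in auto)
    moreover have "(b - d * (b - g 0)) - (a + d * (g 0 - a)) = (1 - d) * (b - a)"
      by (simp add: algebra_simps)
    moreover have "(1 - d) * (b - a) \<le> (1 - d) ^ Suc m * (b0 - a0)"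
      using mult_left_mono[OF g(3), of "1 - d"] d1 by (simp add: mult.assoc)
    ultimately show ?case using R_pow[OF g(1), of N] by (metis (lifting))
  qed
  have "(\<lambda>m. (1 - d) ^ m * (b0 - a0)) \<longlonglongrightarrow> 0 * (b0 - a0)"
    by (intro tendsto_intros LIMSEQ_power_zero) (use d0 d1 in auto)
  \<comment> \<open>The oscillation is made smaller than the distance of the mean from 0; since the
    lower end \<open>a\<close> is at most the mean, the upper end \<open>b\<close> is then
    negative.\<close>
  then have "eventually (\<lambda>m. (1 - d) ^ m * (b0 - a0) < - (\<Sum>i<s. p i * f i)) sequentially"
    by (rule order_tendstoD) (use neg in auto)
  then obtain m where m: "(1 - d) ^ m * (b0 - a0) < - (\<Sum>i<s. p i * f i)"
    by (auto simp: eventually_sequentially)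
  obtain g a b where g: "R g" "\<forall>i<s. a \<le> g i \<and> g i \<le> b" "b - a \<le> (1 - d) ^ m * (b0 - a0)"
    using osc by blast
  have "a = (\<Sum>i<s. p i * a)" using p(2) by (simp flip: sum_distrib_right)
  also have "\<dots> \<le> (\<Sum>i<s. p i * g i)" using g(2) p(1) by (intro sum_mono mult_left_mono) auto
  finally have "b < 0" using p_mean[OF g(1)] g(3) m by simp
  moreover obtain v where "\<forall>i<s. g i = f i + (\<Sum>j<s. M i j * v j) - v i"
    using g(1) by (auto simp: R_def)
  ultimately show thesis using g(2) by (intro that[of v]) (metis order_le_less_trans)
qed

subsection \<open>Paths in the plane and in the quadrant\<close>

text \<open>The real entries of \<open>Atheta\<close>. The powers are the exponential generating
  functions of the displacement after \<open>n\<close> steps; the next bounds exploit this from both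
  sides.\<close>

definition tilt :: "(int \<Rightarrow> int \<Rightarrow> nat \<Rightarrow> nat \<Rightarrow> real) \<Rightarrow> real \<times> real \<Rightarrow> nat \<Rightarrow> nat \<Rightarrow> real" where
  "tilt A \<theta> i j = (\<Sum>k\<in>steps. \<Sum>l\<in>steps. exp (real_of_int k * fst \<theta> + real_of_int l * snd \<theta>) * A k l i j)"

lemma Atheta_eq_cmat: "Atheta s0 A \<theta> = cmat s0 (tilt A \<theta>)"
  by (simp add: Atheta_def tilt_def)

lemma tilt_0: "tilt A (0, 0) = Astar A"
  by (intro ext) (simp add: tilt_def Astar_def)

lemma pstep_translate:
  "pstep s0 n A (x1 + a, x2 + b, i) (y1 + a, y2 + b, j) = pstep s0 n A (x1, x2, i) (y1, y2, j)"
proof (induction n arbitrary: x1 x2 i)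
  case (Suc n)
  have "x1 + a + k = (x1 + k) + a" "x2 + b + l = (x2 + l) + b" for k l by simp_all
  then show ?case by (simp only: pstep.simps Suc)
qed simp

lemma pstep_translate_0:
  "pstep s0 n A (x1, x2, i) (y1, y2, j) = pstep s0 n A (0, 0, i) (y1 - x1, y2 - x2, j)"
  using pstep_translate[of s0 n A 0 x1 0 x2 i "y1 - x1" "y2 - x2" j] by simp

locale qbd =
  fixes s0 :: nat and A :: "int \<Rightarrow> int \<Rightarrow> nat \<Rightarrow> nat \<Rightarrow> real"
  assumes blocks: "qbd_blocks s0 A"
begin

lemma s0_pos: "0 < s0"
  using blocks by (simp add: qbd_blocks_def)

lemma A_nonneg: "0 \<le> A k l i j"
  using blocks by (simp add: qbd_blocks_def)

lemma tilt_nonneg: "0 \<le> tilt A \<theta> i j"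
  unfolding tilt_def by (intro sum_nonneg mult_nonneg_nonneg A_nonneg) simp

lemma pstep_nonneg: "0 \<le> pstep s0 n A y z"
proof (induction n arbitrary: y)
  case (Suc n)
  obtain x1 x2 i where "y = (x1, x2, i)" by (cases y)
  then show ?case by (auto intro!: sum_nonneg mult_nonneg_nonneg A_nonneg Suc)
qed simp

lemma pplus_nonneg: "0 \<le> pplus s0 n A y z"
proof (induction n arbitrary: y)
  case (Suc n)
  obtain x1 x2 i where "y = (x1, x2, i)" by (cases y)
  then show ?case by (auto intro!: sum_nonneg mult_nonneg_nonneg A_nonneg Suc)
qed simp

lemma pstep_mult_le: "pstep s0 n A x y * pstep s0 m A y z \<le> pstep s0 (n + m) A x z"
proof (induction n arbitrary: x)
  case (Suc n)
  obtain x1 x2 i where x: "x = (x1, x2, i)" by (cases x)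
  have "pstep s0 (Suc n) A x y * pstep s0 m A y z
      = (\<Sum>k\<in>steps. \<Sum>l\<in>steps. \<Sum>j<s0. A k l i j * (pstep s0 n A (x1 + k, x2 + l, j) y * pstep s0 m A y z))"
    by (simp add: x sum_distrib_right mult.assoc)
  also have "\<dots> \<le> pstep s0 (Suc n + m) A x z"
    unfolding x add_Suc pstep.simps by (intro sum_mono mult_left_mono Suc A_nonneg)
  finally show ?case .
qed (simp add: pstep_nonneg)

lemma pplus_mult_le: "pplus s0 n A x y * pplus s0 m A y z \<le> pplus s0 (n + m) A x z"
proof (induction n arbitrary: x)
  case (Suc n)
  obtain x1 x2 i where x: "x = (x1, x2, i)" by (cases x)
  show ?case
  proof (cases "x \<in> Splus s0")
    case True
    then have "pplus s0 (Suc n) A x y * pplus s0 m A y z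
        = (\<Sum>k\<in>steps. \<Sum>l\<in>steps. \<Sum>j<s0. A k l i j * (pplus s0 n A (x1 + k, x2 + l, j) y * pplus s0 m A y z))"
      by (simp add: x sum_distrib_right mult.assoc)
    also have "\<dots> \<le> (\<Sum>k\<in>steps. \<Sum>l\<in>steps. \<Sum>j<s0. A k l i j * pplus s0 (n + m) A (x1 + k, x2 + l, j) z)"
      by (intro sum_mono mult_left_mono Suc A_nonneg)
    finally show ?thesis using True by (simp add: x)
  qed (simp add: x)
qed (simp add: pplus_nonneg)

text \<open>A path in the quadrant stays there when shifted away from the axes; the shifted end
  points may be joined by further paths, hence only an inequality.\<close>

lemma pplus_translate_le:
  assumes "0 \<le> a" "0 \<le> b"
  shows "pplus s0 n A (x1, x2, i) (y1, y2, j) \<le> pplus s0 n A (x1 + a, x2 + b, i) (y1 + a, y2 + b, j)"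
proof (induction n arbitrary: x1 x2 i)
  case 0
  then show ?case using assms by (auto simp: Splus_def)
next
  case (Suc n)
  have Splus: "(x1 + a, x2 + b, i) \<in> Splus s0" if "(x1, x2, i) \<in> Splus s0"
    using that assms by (auto simp: Splus_def)
  have eq: "x1 + a + k = (x1 + k) + a" "x2 + b + l = (x2 + l) + b" for k l by simp_all
  show ?case
  proof (cases "(x1, x2, i) \<in> Splus s0")
    case True
    then show ?thesis
      unfolding pplus.simps eq if_P[OF True] if_P[OF Splus[OF True]]
      by (intro sum_mono mult_left_mono Suc A_nonneg)
  next
    case False
    then have "pplus s0 (Suc n) A (x1, x2, i) (y1, y2, j) = 0" by simp
    then show ?thesis by (simp only: pplus_nonneg)
  qed
qed

lemma pplus_le_pstep: "pplus s0 n A y z \<le> pstep s0 n A y z"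
proof (induction n arbitrary: y)
  case (Suc n)
  obtain x1 x2 i where y: "y = (x1, x2, i)" by (cases y)
  show ?case
  proof (cases "y \<in> Splus s0")
    case True
    then show ?thesis unfolding y pplus.simps pstep.simps
      by (auto intro!: sum_mono mult_left_mono Suc A_nonneg)
  next
    case False
    then show ?thesis using pstep_nonneg[of "Suc n" y z] by (simp add: y)
  qed
qed simp

text \<open>A step lowers each coordinate by at most 1, so \<open>n\<close> steps from a point with
  coordinates at least \<open>n\<close> cannot leave the quadrant.\<close>

lemma pplus_eq_pstep_if_far:
  assumes "int n \<le> x1" "int n \<le> x2" "i < s0"
  shows "pplus s0 n A (x1, x2, i) y = pstep s0 n A (x1, x2, i) y"
  using assms
proof (induction n arbitrary: x1 x2 i)
  case 0
  then show ?case by (auto simp: Splus_def)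
next
  case (Suc n)
  have "(x1, x2, i) \<in> Splus s0" using Suc.prems by (auto simp: Splus_def)
  moreover have "pplus s0 n A (x1 + k, x2 + l, j) y = pstep s0 n A (x1 + k, x2 + l, j) y"
    if "k \<in> steps" "l \<in> steps" "j < s0" for k l j
    using that Suc.prems by (intro Suc.IH) (auto simp: steps_def)
  ultimately show ?case unfolding pplus.simps pstep.simps by (auto intro!: sum.cong)
qed

text \<open>The tilted power sums these weighted probabilities over all displacements, and one term
  is at most the sum.\<close>

lemma pstep_tilt_le_mpow:
  "pstep s0 n A (x1, x2, i) (y1, y2, j) * exp (of_int (y1 - x1) * fst \<theta> + of_int (y2 - x2) * snd \<theta>)
    \<le> mpow s0 (tilt A \<theta>) n i j"
proof (induction n arbitrary: x1 x2 i)
  case (Suc n)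
  let ?e = "\<lambda>a b. exp (of_int a * fst \<theta> + of_int b * snd \<theta>)"
  \<comment> \<open>The weight is multiplicative along the path: the first step's share enters
    \<open>tilt\<close>, the rest goes to the induction hypothesis.\<close>
  have split: "?e (y1 - x1) (y2 - x2) = ?e k l * ?e (y1 - (x1 + k)) (y2 - (x2 + l))" for k l
    by (simp add: exp_add[symmetric] algebra_simps)
  have regroup: "A k l i m * pstep s0 n A (x1 + k, x2 + l, m) (y1, y2, j) * ?e (y1 - x1) (y2 - x2)
      = (?e k l * A k l i m)
      * (pstep s0 n A (x1 + k, x2 + l, m) (y1, y2, j) * ?e (y1 - (x1 + k)) (y2 - (x2 + l)))" for k l m
    unfolding split[of k l] by (simp only: mult_ac)
  have "pstep s0 (Suc n) A (x1, x2, i) (y1, y2, j) * ?e (y1 - x1) (y2 - x2)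
     = (\<Sum>k\<in>steps. \<Sum>l\<in>steps. \<Sum>m<s0. A k l i m * pstep s0 n A (x1 + k, x2 + l, m) (y1, y2, j)
          * ?e (y1 - x1) (y2 - x2))"
    by (simp only: pstep.simps sum_distrib_right)
  also have "\<dots> = (\<Sum>k\<in>steps. \<Sum>l\<in>steps. \<Sum>m<s0. (?e k l * A k l i m)
      * (pstep s0 n A (x1 + k, x2 + l, m) (y1, y2, j) * ?e (y1 - (x1 + k)) (y2 - (x2 + l))))"
    by (intro sum.cong refl regroup)
  also have "\<dots> \<le> (\<Sum>k\<in>steps. \<Sum>l\<in>steps. \<Sum>m<s0. (?e k l * A k l i m) * mpow s0 (tilt A \<theta>) n m j)"
    by (intro sum_mono mult_left_mono Suc mult_nonneg_nonneg A_nonneg) simp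
  also have "\<dots> = (\<Sum>k\<in>steps. \<Sum>m<s0. \<Sum>l\<in>steps. (?e k l * A k l i m) * mpow s0 (tilt A \<theta>) n m j)"
    by (intro sum.cong refl sum.swap)
  also have "\<dots> = (\<Sum>m<s0. \<Sum>k\<in>steps. \<Sum>l\<in>steps. (?e k l * A k l i m) * mpow s0 (tilt A \<theta>) n m j)"
    by (rule sum.swap)
  also have "\<dots> = mpow s0 (tilt A \<theta>) (Suc n) i j"
    by (simp only: mpow.simps tilt_def sum_distrib_right)
  finally show ?case .
qed simp

text \<open>In the opposite direction, \<open>n\<close> steps reach only end points in the box of
  radius \<open>n\<close>, so the finite sum already accounts for the whole tilted power.\<close>

lemma mpow_tilt_le_sum_pstep:
  assumes "n \<le> N"
  shows "mpow s0 (tilt A \<theta>) n i j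
    \<le> (\<Sum>(a, b)\<in>{- int N..int N} \<times> {- int N..int N}.
          pstep s0 n A (0, 0, i) (a, b, j) * exp (of_int a * fst \<theta> + of_int b * snd \<theta>))"
  using assms
proof (induction n arbitrary: i N)
  case 0
  let ?F = "\<lambda>(a, b). pstep s0 0 A (0, 0, i) (a, b, j) * exp (of_int a * fst \<theta> + of_int b * snd \<theta>)"
  have "?F (0, 0) \<le> sum ?F ({- int N..int N} \<times> {- int N..int N})"
    by (intro member_le_sum) auto
  then show ?case by simp
next
  case (Suc n)
  let ?e = "\<lambda>a b. exp (of_int a * fst \<theta> + of_int b * snd \<theta>)"
  let ?box = "\<lambda>N. {- int N..int N} \<times> {- int N..int N}"
  obtain N' where N: "N = Suc N'" "n \<le> N'" using Suc.prems by (cases N) auto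
  \<comment> \<open>The smaller box, shifted by the first step \<open>(k, l)\<close>, lies in the
    larger one, and the additional terms are nonnegative.\<close>
  have shift: "(?e k l * A k l i m) * mpow s0 (tilt A \<theta>) n m j
      \<le> (\<Sum>(a, b)\<in>?box N. A k l i m * pstep s0 n A (k, l, m) (a, b, j) * ?e a b)"
    if "k \<in> steps" "l \<in> steps" for k l m
  proof -
    let ?s = "\<lambda>(a, b). (a + k, b + l)"
    let ?F = "\<lambda>(a, b). A k l i m * pstep s0 n A (k, l, m) (a, b, j) * ?e a b"
    have "(?e k l * A k l i m) * mpow s0 (tilt A \<theta>) n m j
        \<le> (?e k l * A k l i m) * (\<Sum>(a, b)\<in>?box N'. pstep s0 n A (0, 0, m) (a, b, j) * ?e a b)"
      by (intro mult_left_mono Suc.IH N mult_nonneg_nonneg A_nonneg) simp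
    also have "\<dots> = (\<Sum>(a, b)\<in>?box N'. ?F (?s (a, b)))"
    proof -
      have "pstep s0 n A (k, l, m) (a + k, b + l, j) = pstep s0 n A (0, 0, m) (a, b, j)" for a b
        using pstep_translate[of s0 n A 0 k 0 l m a b j] by simp
      moreover have "?e (a + k) (b + l) = ?e k l * ?e a b" for a b
        by (simp add: exp_add[symmetric] algebra_simps)
      ultimately show ?thesis
        by (simp only: sum_distrib_left case_prod_unfold fst_conv snd_conv) (simp only: mult_ac)
    qed
    also have "\<dots> = sum (?F \<circ> ?s) (?box N')"
      by (simp add: case_prod_unfold comp_def)
    also have "\<dots> = sum ?F (?s ` ?box N')"
      by (rule sum.reindex[symmetric]) (auto simp: inj_on_def)
    also have "\<dots> \<le> sum ?F (?box N)"
      using that N by (intro sum_mono2) (auto simp: steps_def intro!: mult_nonneg_nonneg A_nonneg pstep_nonneg)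
    finally show ?thesis .
  qed
  have "mpow s0 (tilt A \<theta>) (Suc n) i j
      = (\<Sum>m<s0. \<Sum>k\<in>steps. \<Sum>l\<in>steps. (?e k l * A k l i m) * mpow s0 (tilt A \<theta>) n m j)"
    by (simp only: mpow.simps tilt_def sum_distrib_right)
  also have "\<dots> = (\<Sum>k\<in>steps. \<Sum>m<s0. \<Sum>l\<in>steps. (?e k l * A k l i m) * mpow s0 (tilt A \<theta>) n m j)"
    by (rule sum.swap)
  also have "\<dots> = (\<Sum>k\<in>steps. \<Sum>l\<in>steps. \<Sum>m<s0. (?e k l * A k l i m) * mpow s0 (tilt A \<theta>) n m j)"
    by (intro sum.cong refl sum.swap)
  also have "\<dots> \<le> (\<Sum>k\<in>steps. \<Sum>l\<in>steps. \<Sum>m<s0. \<Sum>(a, b)\<in>?box N.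
      A k l i m * pstep s0 n A (k, l, m) (a, b, j) * ?e a b)"
    by (intro sum_mono shift)
  \<comment> \<open>The sum over end points moves outward until the inner sums form one step of
    \<open>pstep\<close>.\<close>
  also have "\<dots> = (\<Sum>k\<in>steps. \<Sum>l\<in>steps. \<Sum>(a, b)\<in>?box N. \<Sum>m<s0.
      A k l i m * pstep s0 n A (k, l, m) (a, b, j) * ?e a b)"
    unfolding case_prod_unfold by (intro sum.cong refl sum.swap)
  also have "\<dots> = (\<Sum>k\<in>steps. \<Sum>(a, b)\<in>?box N. \<Sum>l\<in>steps. \<Sum>m<s0.
      A k l i m * pstep s0 n A (k, l, m) (a, b, j) * ?e a b)"
    unfolding case_prod_unfold by (intro sum.cong refl sum.swap)
  also have "\<dots> = (\<Sum>(a, b)\<in>?box N. \<Sum>k\<in>steps. \<Sum>l\<in>steps. \<Sum>m<s0.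
      A k l i m * pstep s0 n A (k, l, m) (a, b, j) * ?e a b)"
    unfolding case_prod_unfold by (rule sum.swap)
  also have "\<dots> = (\<Sum>(a, b)\<in>?box N. pstep s0 (Suc n) A (0, 0, i) (a, b, j) * ?e a b)"
    by (simp add: sum_distrib_right)
  finally show ?case .
qed

text \<open>The number of end points is polynomial in \<open>n\<close>, so a bound on single
  probabilities has the same exponential rate as a bound on the power.\<close>

lemma mpow_tilt_le_if_pstep_le:
  assumes le: "\<And>a b. pstep s0 n A (0, 0, i) (a, b, j) * exp (of_int a * fst \<theta> + of_int b * snd \<theta>) \<le> c"
  shows "mpow s0 (tilt A \<theta>) n i j \<le> (2 * real n + 1)\<^sup>2 * c"
proof -
  let ?box = "{- int n..int n} \<times> {- int n..int n}"
  have "mpow s0 (tilt A \<theta>) n i j \<le> (\<Sum>(a, b)\<in>?box.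
          pstep s0 n A (0, 0, i) (a, b, j) * exp (of_int a * fst \<theta> + of_int b * snd \<theta>))"
    by (rule mpow_tilt_le_sum_pstep) simp
  also have "\<dots> \<le> (\<Sum>z\<in>?box. c)"
    using le by (intro sum_mono) auto
  also have "\<dots> = (2 * real n + 1)\<^sup>2 * c"
    by (simp add: card_cartesian_product power2_eq_square algebra_simps)
  finally show ?thesis .
qed

end

subsection \<open>Points of Gamma and exponential bounds for cycles\<close>

context qbd
begin

lemma Gamma_geometric_bound:
  assumes "\<theta> \<in> Gamma s0 A"
  obtains C r where "0 < r" "r < 1" "0 < C"
    "\<And>n i j. i < s0 \<Longrightarrow> j < s0 \<Longrightarrow> mpow s0 (tilt A \<theta>) n i j \<le> C * r ^ n"
proof -
  have "spectral_radius (cmat s0 (tilt A \<theta>)) < 1"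
    using assms by (simp add: Gamma_def Atheta_eq_cmat)
  then show thesis by (rule mpow_geometric_bound[OF tilt_nonneg s0_pos]) (rule that)
qed

text \<open>Repeating a cycle removes the constant: if a diagonal entry exceeded
  \<open>r ^ n\<close>, the powers of the quotient would outgrow \<open>C\<close>. The constant-free
  form bounds the exponent of every single cycle.\<close>

lemma Gamma_cycle_bound:
  assumes th: "\<theta> \<in> Gamma s0 A" and j: "j < s0"
  obtains r where "0 < r" "r < 1"
    "\<And>n a b. pstep s0 n A (0, 0, j) (a, b, j) * exp (of_int a * fst \<theta> + of_int b * snd \<theta>) \<le> r ^ n"
proof -
  obtain C r where r: "0 < r" "r < 1" "0 < C"
    and Cr: "\<And>n i j. i < s0 \<Longrightarrow> j < s0 \<Longrightarrow> mpow s0 (tilt A \<theta>) n i j \<le> C * r ^ n"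
    by (rule Gamma_geometric_bound[OF th]) (rule that)
  have diag: "mpow s0 (tilt A \<theta>) n j j \<le> r ^ n" for n
  proof (rule ccontr)
    assume "\<not> ?thesis"
    then have "1 < mpow s0 (tilt A \<theta>) n j j / r ^ n" using r by simp
    then obtain k where k: "C < (mpow s0 (tilt A \<theta>) n j j / r ^ n) ^ k"
      using real_arch_pow by blast
    have "mpow s0 (tilt A \<theta>) n j j ^ k \<le> C * r ^ (k * n)"
      using mpow_diag_power_le[of "tilt A \<theta>" s0 n j k, OF tilt_nonneg] Cr[OF j j, of "k * n"] by simp
    then have "(mpow s0 (tilt A \<theta>) n j j / r ^ n) ^ k \<le> C"
      using r by (simp add: power_divide divide_le_eq mult.commute flip: power_mult)
    then show False using k by simp
  qed
  show thesis
  proof (rule that[OF r(1,2)])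
    fix n a b
    show "pstep s0 n A (0, 0, j) (a, b, j) * exp (of_int a * fst \<theta> + of_int b * snd \<theta>) \<le> r ^ n"
      using pstep_tilt_le_mpow[of n 0 0 j a b j \<theta>] diag[of n] by simp
  qed
qed

end

locale irreducible_qbd = qbd +
  assumes irr: "chain_irreducible s0 A"
begin

lemma pstep_pos:
  assumes "i < s0" "j < s0"
  shows "\<exists>n. 0 < pstep s0 n A (x1, x2, i) (y1, y2, j)"
  using irr assms by (auto simp: chain_irreducible_def Sfull_def)

lemma mpow_tilt_pos:
  assumes "i < s0" "j < s0"
  shows "\<exists>n. 0 < mpow s0 (tilt A \<theta>) n i j"
proof -
  obtain n where "0 < pstep s0 n A (0, 0, i) (0, 0, j)" using pstep_pos[OF assms] by blast
  then show ?thesis using pstep_tilt_le_mpow[of n 0 0 i 0 0 j \<theta>] by (intro exI[of _ n]) simp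
qed

text \<open>A converse to \<open>Gamma_cycle_bound\<close>: the bound at one phase makes its
  diagonal entry decay up to a polynomial factor, and irreducibility carries the decay to all
  entries.\<close>

lemma Gamma_if_cycle_bound:
  assumes j: "j < s0" and r: "0 < r" "r < 1"
    and le: "\<And>n a b. pstep s0 n A (0, 0, j) (a, b, j) * exp (of_int a * fst \<theta> + of_int b * snd \<theta>) \<le> r ^ n"
  shows "\<theta> \<in> Gamma s0 A"
proof -
  let ?M = "mpow s0 (tilt A \<theta>)"
  have cycle: "?M n j j \<le> (2 * real n + 1)\<^sup>2 * r ^ n" for n
    by (rule mpow_tilt_le_if_pstep_le) (rule le)
  have lim: "(\<lambda>n. (2 * real n + 1)\<^sup>2 * r ^ n) \<longlonglongrightarrow> 0"
  proof -
    \<comment> \<open>Writing \<open>r ^ n\<close> as a square of \<open>sqrt r ^ n\<close> lets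
      each linear factor be absorbed separately.\<close>
    have "(\<lambda>n. (2 * (real n * sqrt r ^ n) + sqrt r ^ n)\<^sup>2) \<longlonglongrightarrow> (2 * 0 + 0)\<^sup>2"
      using r by (intro tendsto_intros powser_times_n_limit_0 LIMSEQ_power_zero) auto
    moreover have "(2 * (real n * sqrt r ^ n) + sqrt r ^ n)\<^sup>2 = (2 * real n + 1)\<^sup>2 * r ^ n" for n
    proof -
      have "2 * (real n * sqrt r ^ n) + sqrt r ^ n = (2 * real n + 1) * sqrt r ^ n"
        by (simp add: algebra_simps)
      moreover have "(sqrt r ^ n)\<^sup>2 = r ^ n"
        using r by (simp flip: real_sqrt_power)
      ultimately show ?thesis by (simp add: power_mult_distrib)
    qed
    ultimately show ?thesis by simp
  qed
  have "(\<lambda>n. ?M n i l) \<longlonglongrightarrow> 0" if il: "i < s0" "l < s0" for i l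
  proof -
    obtain p q where p: "0 < ?M p j i" and q: "0 < ?M q l j"
      using mpow_tilt_pos il j by metis
    \<comment> \<open>Fixed connections from \<open>j\<close> to \<open>i\<close> and from
      \<open>l\<close> to \<open>j\<close> close the path into a cycle at \<open>j\<close>.\<close>
    have "?M n i l \<le> ((2 * real (n + (p + q)) + 1)\<^sup>2 * r ^ (n + (p + q))) / (?M p j i * ?M q l j)" for n
    proof -
      have "?M p j i * ?M n i l * ?M q l j \<le> ?M (p + n) j l * ?M q l j"
        by (intro mult_right_mono mpow_mult_le mpow_nonneg tilt_nonneg)
      also have "\<dots> \<le> ?M (p + n + q) j j" by (intro mpow_mult_le tilt_nonneg)
      also have "p + n + q = n + (p + q)" by simp
      finally show ?thesis using p q cycle[of "n + (p + q)"]
        by (simp add: pos_le_divide_eq mult_ac del: of_nat_add)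
    qed
    moreover have "(\<lambda>n. ((2 * real (n + (p + q)) + 1)\<^sup>2 * r ^ (n + (p + q))) / (?M p j i * ?M q l j))
        \<longlonglongrightarrow> 0 / (?M p j i * ?M q l j)"
      by (intro tendsto_divide tendsto_const LIMSEQ_ignore_initial_segment[OF lim]) (use p q in auto)
    ultimately show ?thesis
      by (intro tendsto_sandwich[of "\<lambda>_. 0" "\<lambda>n. ?M n i l"])
        (auto intro!: always_eventually mpow_nonneg tilt_nonneg simp del: of_nat_add)
  qed
  then show ?thesis
    unfolding Gamma_def Atheta_eq_cmat using spectral_radius_less_1_if_mpow_tendsto_0[OF s0_pos] by simp
qed

section \<open>Nonemptiness of Gamma under negative drift\<close>

lemma Astar_row_sum:
  assumes "i < s0"
  shows "(\<Sum>j<s0. Astar A i j) = 1"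
proof -
  have "(\<Sum>j<s0. Astar A i j) = (\<Sum>k\<in>steps. \<Sum>j<s0. \<Sum>l\<in>steps. A k l i j)"
    unfolding Astar_def by (rule sum.swap)
  also have "\<dots> = (\<Sum>k\<in>steps. \<Sum>l\<in>steps. \<Sum>j<s0. A k l i j)"
    by (intro sum.cong refl sum.swap)
  finally show ?thesis using blocks assms by (simp add: qbd_blocks_def)
qed

text \<open>At \<open>\<theta> = 0\<close> the vector \<open>1\<close> is harmonic. Along a direction of negative drift, the first-order
  correction \<open>1 + t v\<close> with \<open>v\<close> an approximate solution of the Poisson equation is strictly
  subinvariant.\<close>

lemma Gamma_nonempty_if_directional_drift:
  assumes st: "stationary s0 A p"
    and neg: "(\<Sum>i<s0. p i * (\<Sum>j<s0. \<Sum>k\<in>steps. \<Sum>l\<in>steps. (of_int k * \<alpha> + of_int l * \<beta>) * A k l i j)) < 0"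
  shows "Gamma s0 A \<noteq> {}"
proof -
  define f where "f = (\<lambda>i. \<Sum>j<s0. \<Sum>k\<in>steps. \<Sum>l\<in>steps. (of_int k * \<alpha> + of_int l * \<beta>) * A k l i j)"
  obtain v where v: "\<And>i. i < s0 \<Longrightarrow> f i + (\<Sum>j<s0. Astar A i j * v j) - v i < 0"
  proof (rule poisson_strict_inequality[of "Astar A" s0 p f])
    show "0 \<le> Astar A i j" for i j using tilt_nonneg[of "(0, 0)"] by (simp add: tilt_0)
    show "\<exists>n. 0 < mpow s0 (Astar A) n i 0" if "i < s0" for i
      using mpow_tilt_pos[OF that s0_pos, of "(0, 0)"] by (simp add: tilt_0)
  qed (use st neg s0_pos Astar_row_sum in \<open>auto simp: stationary_def f_def\<close>)
  \<comment> \<open>Negativity of \<open>F i t\<close> for all \<open>i\<close> is strict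
    subinvariance of \<open>1 + t * v\<close>; \<open>F\<close> vanishes at 0 and its derivative
    there is negative by the choice of \<open>v\<close>.\<close>
  define F where "F = (\<lambda>i t. (\<Sum>j<s0. tilt A (t * \<alpha>, t * \<beta>) i j * (1 + t * v j)) - (1 + t * v i))"
  have F0: "F i 0 = 0" if "i < s0" for i
    using Astar_row_sum[OF that] by (simp add: F_def tilt_0)
  have tilt_deriv: "((\<lambda>t. tilt A (t * \<alpha>, t * \<beta>) i j) has_real_derivative
      (\<Sum>k\<in>steps. \<Sum>l\<in>steps. (of_int k * \<alpha> + of_int l * \<beta>) * A k l i j)) (at 0)" for i j
    unfolding tilt_def by (auto intro!: derivative_eq_intros DERIV_sum)
  have deriv: "(F i has_real_derivative (f i + (\<Sum>j<s0. Astar A i j * v j) - v i)) (at 0)" for i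
  proof -
    have "((\<lambda>t. tilt A (t * \<alpha>, t * \<beta>) i j * (1 + t * v j)) has_real_derivative
        ((\<Sum>k\<in>steps. \<Sum>l\<in>steps. (of_int k * \<alpha> + of_int l * \<beta>) * A k l i j) + Astar A i j * v j)) (at 0)" for j
      by (rule derivative_eq_intros tilt_deriv refl)+ (simp add: tilt_0)
    then have "((\<lambda>t. \<Sum>j<s0. tilt A (t * \<alpha>, t * \<beta>) i j * (1 + t * v j)) has_real_derivative
        (\<Sum>j<s0. (\<Sum>k\<in>steps. \<Sum>l\<in>steps. (of_int k * \<alpha> + of_int l * \<beta>) * A k l i j) + Astar A i j * v j)) (at 0)"
      by (intro DERIV_sum)
    moreover have "((\<lambda>t. 1 + t * v i) has_real_derivative v i) (at 0)"
      by (auto intro!: derivative_eq_intros)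
    ultimately have "((\<lambda>t. (\<Sum>j<s0. tilt A (t * \<alpha>, t * \<beta>) i j * (1 + t * v j)) - (1 + t * v i)) has_real_derivative
        (\<Sum>j<s0. (\<Sum>k\<in>steps. \<Sum>l\<in>steps. (of_int k * \<alpha> + of_int l * \<beta>) * A k l i j) + Astar A i j * v j) - v i) (at 0)"
      by (rule DERIV_diff)
    then show ?thesis by (simp only: F_def f_def sum.distrib)
  qed
  have ev1: "eventually (\<lambda>t. F i t < 0) (at_right 0)" if i: "i < s0" for i
  proof -
    obtain d where "0 < d" "\<forall>h>0. h < d \<longrightarrow> F i 0 > F i (0 + h)"
      using DERIV_neg_dec_right[OF deriv v[OF i]] by blast
    then show ?thesis using F0[OF i] by (auto simp: eventually_at_right intro!: exI[of _ d])
  qed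
  have ev2: "eventually (\<lambda>t. 0 < 1 + t * v i) (at_right 0)" for i
  proof -
    have "((\<lambda>t. 1 + t * v i) \<longlongrightarrow> 1 + 0 * v i) (at_right 0)" by (intro tendsto_intros)
    then show ?thesis by (rule order_tendstoD) simp
  qed
  have "eventually (\<lambda>t. \<forall>i\<in>{..<s0}. F i t < 0 \<and> 0 < 1 + t * v i) (at_right 0)"
    by (intro eventually_ball_finite ballI eventually_conj ev1 ev2) auto
  then obtain t where t: "\<forall>i\<in>{..<s0}. F i t < 0 \<and> 0 < 1 + t * v i"
    using eventually_happens[of _ "at_right (0::real)"] by auto
  have "spectral_radius (cmat s0 (tilt A (t * \<alpha>, t * \<beta>))) < 1"
    by (rule spectral_radius_less_1_if_subinvariant[of _ s0 "\<lambda>i. 1 + t * v i"])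
      (use t s0_pos in \<open>auto simp: F_def intro: tilt_nonneg\<close>)
  then show ?thesis by (auto simp: Gamma_def Atheta_eq_cmat)
qed

text \<open>The two drifts are the directional ones for \<open>(1, 0)\<close> and
  \<open>(0, 1)\<close>.\<close>

lemma Gamma_nonempty:
  assumes "stationary s0 A p" "drift1 s0 A p < 0 \<or> drift2 s0 A p < 0"
  shows "Gamma s0 A \<noteq> {}"
  using assms(2)
proof
  assume "drift1 s0 A p < 0"
  moreover have "drift1 s0 A p
      = (\<Sum>i<s0. p i * (\<Sum>j<s0. \<Sum>k\<in>steps. \<Sum>l\<in>steps. (of_int k * 1 + of_int l * 0) * A k l i j))"
    by (simp add: drift1_def steps_def sum.distrib sum_negf sum_subtractf algebra_simps)
  ultimately show ?thesis using Gamma_nonempty_if_directional_drift[OF assms(1), of 1 0] by simp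
next
  assume "drift2 s0 A p < 0"
  moreover have "drift2 s0 A p
      = (\<Sum>i<s0. p i * (\<Sum>j<s0. \<Sum>k\<in>steps. \<Sum>l\<in>steps. (of_int k * 0 + of_int l * 1) * A k l i j))"
    by (simp add: drift2_def steps_def sum.distrib sum_negf sum_subtractf algebra_simps)
  ultimately show ?thesis using Gamma_nonempty_if_directional_drift[OF assms(1), of 0 1] by simp
qed

end

subsection \<open>Supporting functionals of sublinear functions on the integer lattice\<close>

text \<open>A Hahn-Banach extension by hand: from the multiples of \<open>c\<close> to the
  sublattice spanned by \<open>c\<close> and \<open>(0, 1)\<close>, then to the whole lattice
  through division by \<open>c1\<close>.\<close>

lemma sublinear_lattice_support:
  fixes h :: "int \<Rightarrow> int \<Rightarrow> real" and c1 c2 :: int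
  assumes sub: "\<And>a b a' b'. h (a + a') (b + b') \<le> h a b + h a' b'"
    and hom: "\<And>m a b. 0 < m \<Longrightarrow> h (m * a) (m * b) = of_int m * h a b"
    and c1: "0 < c1"
  obtains t1 t2 where "\<And>a b. of_int a * t1 + of_int b * t2 \<le> h a b"
    "of_int c1 * t1 + of_int c2 * t2 = h c1 c2"
proof -
  have h0: "h 0 0 = 0" using hom[of 2 0 0] by simp
  have line: "of_int a * h c1 c2 \<le> h (a * c1) (a * c2)" for a
  proof (cases "0 < a")
    case True
    then show ?thesis using hom[of a c1 c2] by simp
  next
    case False
    show ?thesis
    proof (cases "a = 0")
      case True then show ?thesis using h0 by simp
    next
      case a: False
      have "0 \<le> h (a * c1) (a * c2) + h (- a * c1) (- a * c2)"
        using sub[of "a * c1" "- a * c1" "a * c2" "- a * c2"] h0 by simp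
      then show ?thesis using hom[of "- a" c1 c2] False a by simp
    qed
  qed
  \<comment> \<open>The upper bounds that domination by \<open>h\<close> imposes on the value at
    \<open>(0, 1)\<close>.\<close>
  define U where "U = {(h (a * c1) (a * c2 + m) - of_int a * h c1 c2) / of_int m | a m. 0 < m}"
  \<comment> \<open>No lower bound exceeds an upper bound: with weights \<open>m\<close> and
    \<open>m'\<close> the offsets from the line through \<open>c\<close> cancel, and
    \<open>line\<close> applies.\<close>
  have bound: "(of_int a' * h c1 c2 - h (a' * c1) (a' * c2 - m')) / of_int m'
      \<le> (h (a * c1) (a * c2 + m) - of_int a * h c1 c2) / of_int m"
    if "0 < m" "0 < m'" for a a' m m'
  proof -
    let ?H = "h c1 c2"
    have "of_int (m' * a + m * a') * ?H \<le> h ((m' * a + m * a') * c1) ((m' * a + m * a') * c2)"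
      by (rule line)
    also have "\<dots> \<le> h (m' * (a * c1)) (m' * (a * c2 + m)) + h (m * (a' * c1)) (m * (a' * c2 - m'))"
      using sub[of "m' * (a * c1)" "m * (a' * c1)" "m' * (a * c2 + m)" "m * (a' * c2 - m')"]
      by (simp add: algebra_simps)
    also have "\<dots> = of_int m' * h (a * c1) (a * c2 + m) + of_int m * h (a' * c1) (a' * c2 - m')"
      using that by (simp add: hom)
    finally show ?thesis using that by (simp add: field_simps)
  qed
  have ne: "U \<noteq> {}" by (auto simp: U_def intro: exI[of _ 1])
  have bdd: "bdd_below U"
    using bound[where a' = 0 and m' = 1] by (intro bdd_belowI[of _ "(of_int 0 * h c1 c2 - h (0 * c1) (0 * c2 - 1)) / of_int 1"])
      (auto simp: U_def)
  define t2 where "t2 = Inf U"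
  have supp: "of_int a * h c1 c2 + of_int m * t2 \<le> h (a * c1) (a * c2 + m)" for a m
  proof -
    consider "0 < m" | "m = 0" | "m < 0" by linarith
    then show ?thesis
    proof cases
      case 1
      have "t2 \<le> (h (a * c1) (a * c2 + m) - of_int a * h c1 c2) / of_int m"
        unfolding t2_def using 1 by (intro cInf_lower bdd) (auto simp: U_def)
      then show ?thesis using 1 by (simp add: field_simps)
    next
      case 2
      then show ?thesis using line by simp
    next
      case 3
      have "(of_int a * h c1 c2 - h (a * c1) (a * c2 - (- m))) / of_int (- m) \<le> t2"
        unfolding t2_def
      proof (rule cInf_greatest[OF ne])
        fix u assume "u \<in> U"
        then obtain a' m' where "u = (h (a' * c1) (a' * c2 + m') - of_int a' * h c1 c2) / of_int m'" "0 < m'"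
          by (auto simp: U_def)
        then show "(of_int a * h c1 c2 - h (a * c1) (a * c2 - (- m))) / of_int (- m) \<le> u"
          using bound[where a = a' and m = m' and a' = a and m' = "- m"] 3 by simp
      qed
      then show ?thesis using 3 by (simp add: field_simps)
    qed
  qed
  define t1 where "t1 = (h c1 c2 - of_int c2 * t2) / of_int c1"
  have c1t1: "of_int c1 * t1 + of_int c2 * t2 = h c1 c2" using c1 by (simp add: t1_def)
  show thesis
  proof (rule that)
    fix x y :: int
    \<comment> \<open>The point \<open>c1 * (x, y)\<close> equals
      \<open>x * c + (c1 * y - x * c2) * (0, 1)\<close>, so it lies in the sublattice.\<close>
    have "of_int c1 * (of_int x * t1 + of_int y * t2)
        = of_int x * h c1 c2 + of_int (c1 * y - x * c2) * t2"
      by (simp add: c1t1[symmetric] algebra_simps)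
    also have "\<dots> \<le> h (x * c1) (x * c2 + (c1 * y - x * c2))" by (rule supp)
    also have "\<dots> = h (c1 * x) (c1 * y)" by (simp add: mult.commute)
    also have "\<dots> = of_int c1 * h x y" by (rule hom[OF c1])
    finally show "of_int x * t1 + of_int y * t2 \<le> h x y" using c1 by simp
  qed (rule c1t1)
qed

subsection \<open>The decay rate of cycles\<close>

context irreducible_qbd
begin

lemma cycle_mult_le:
  "pstep s0 n A (0, 0, j) (a, b, j) * pstep s0 n' A (0, 0, j) (a', b', j)
    \<le> pstep s0 (n + n') A (0, 0, j) (a + a', b + b', j)"
  using pstep_mult_le[of n "(0, 0, j)" "(a, b, j)" n' "(a + a', b + b', j)"]
  by (simp add: pstep_translate_0[of s0 n' A a b])

lemma cycle_power_le:
  "pstep s0 n A (0, 0, j) (a, b, j) ^ m \<le> pstep s0 (m * n) A (0, 0, j) (int m * a, int m * b, j)"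
proof (induction m)
  case (Suc m)
  have "pstep s0 n A (0, 0, j) (a, b, j) ^ Suc m
      \<le> pstep s0 n A (0, 0, j) (a, b, j) * pstep s0 (m * n) A (0, 0, j) (int m * a, int m * b, j)"
    using Suc by (simp add: mult_left_mono pstep_nonneg)
  also have "\<dots> \<le> pstep s0 (n + m * n) A (0, 0, j) (a + int m * a, b + int m * b, j)"
    by (rule cycle_mult_le)
  finally show ?case by (simp add: algebra_simps)
qed simp

text \<open>Start and end phase agree, so cycles can be concatenated. Admitting all multiples
  \<open>k\<close> of the displacement makes the infimum homogeneous.\<close>

definition rates :: "nat \<Rightarrow> int \<Rightarrow> int \<Rightarrow> real set" where
  "rates j a b = {- ln (pstep s0 n A (0, 0, j) (int k * a, int k * b, j)) / real k | k n.
     0 < k \<and> 0 < pstep s0 n A (0, 0, j) (int k * a, int k * b, j)}"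

definition rate :: "nat \<Rightarrow> int \<Rightarrow> int \<Rightarrow> real" where
  "rate j a b = Inf (rates j a b)"

lemma ratesI:
  assumes "0 < k" "0 < pstep s0 n A (0, 0, j) (int k * a, int k * b, j)"
  shows "- ln (pstep s0 n A (0, 0, j) (int k * a, int k * b, j)) / real k \<in> rates j a b"
  unfolding rates_def using assms by blast

lemma rates_nonempty:
  assumes "j < s0"
  shows "rates j a b \<noteq> {}"
proof -
  obtain n where "0 < pstep s0 n A (0, 0, j) (int 1 * a, int 1 * b, j)"
    using pstep_pos[OF assms assms] by blast
  then show ?thesis using ratesI[of 1 n j a b] by auto
qed

text \<open>The constant-free cycle bound is at most 1; its logarithm is the claim.\<close>

lemma rates_lower_bound:
  assumes th: "\<theta> \<in> Gamma s0 A" and j: "j < s0" and z: "z \<in> rates j a b"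
  shows "of_int a * fst \<theta> + of_int b * snd \<theta> \<le> z"
proof -
  obtain k n where k: "0 < k" and w: "0 < pstep s0 n A (0, 0, j) (int k * a, int k * b, j)"
    and z: "z = - ln (pstep s0 n A (0, 0, j) (int k * a, int k * b, j)) / real k"
    using z unfolding rates_def by blast
  let ?w = "pstep s0 n A (0, 0, j) (int k * a, int k * b, j)"
  let ?e = "of_int (int k * a) * fst \<theta> + of_int (int k * b) * snd \<theta>"
  obtain r where r: "0 < r" "r < 1"
    "\<And>n a b. pstep s0 n A (0, 0, j) (a, b, j) * exp (of_int a * fst \<theta> + of_int b * snd \<theta>) \<le> r ^ n"
    by (rule Gamma_cycle_bound[OF th j]) (rule that)
  have "?w * exp ?e \<le> r ^ n" by (rule r(3))
  also have "\<dots> \<le> 1" using r by (simp add: power_le_one)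
  finally have "exp ?e \<le> 1 / ?w" using w by (simp add: pos_le_divide_eq mult.commute)
  also have "\<dots> = exp (- ln ?w)" using w by (simp add: exp_minus inverse_eq_divide)
  finally have "?e \<le> - ln ?w" by simp
  moreover have "?e = (of_int a * fst \<theta> + of_int b * snd \<theta>) * real k" by (simp add: algebra_simps)
  ultimately show ?thesis using k by (simp only: z pos_le_divide_eq of_nat_0_less_iff)
qed

context
  assumes Gamma_ne: "Gamma s0 A \<noteq> {}"
begin

lemma bdd_below_rates: "j < s0 \<Longrightarrow> bdd_below (rates j a b)"
  using Gamma_ne rates_lower_bound by (meson bdd_belowI ex_in_conv)

lemma rate_le:
  assumes "j < s0" "0 < k" "0 < pstep s0 n A (0, 0, j) (int k * a, int k * b, j)"
  shows "rate j a b \<le> - ln (pstep s0 n A (0, 0, j) (int k * a, int k * b, j)) / real k"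
  unfolding rate_def using assms by (intro cInf_lower bdd_below_rates ratesI)

lemma rate_subadditive:
  assumes j: "j < s0"
  shows "rate j (a + a') (b + b') \<le> rate j a b + rate j a' b'"
proof -
  have sum: "rate j (a + a') (b + b') \<le> z + z'" if z: "z \<in> rates j a b" "z' \<in> rates j a' b'" for z z'
  proof -
    obtain k n where k: "0 < k" and w: "0 < pstep s0 n A (0, 0, j) (int k * a, int k * b, j)"
      and zw: "z = - ln (pstep s0 n A (0, 0, j) (int k * a, int k * b, j)) / real k"
      using z(1) unfolding rates_def by blast
    obtain k' n' where k': "0 < k'" and w': "0 < pstep s0 n' A (0, 0, j) (int k' * a', int k' * b', j)"
      and zw': "z' = - ln (pstep s0 n' A (0, 0, j) (int k' * a', int k' * b', j)) / real k'"
      using z(2) unfolding rates_def by blast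
    let ?w = "pstep s0 n A (0, 0, j) (int k * a, int k * b, j)"
    let ?w' = "pstep s0 n' A (0, 0, j) (int k' * a', int k' * b', j)"
    let ?W = "pstep s0 (k' * n + k * n') A (0, 0, j) (int (k * k') * (a + a'), int (k * k') * (b + b'), j)"
    \<comment> \<open>Repeating the cycles \<open>k'\<close> and \<open>k\<close> times brings both
      displacements to the common multiple \<open>k * k'\<close>.\<close>
    have "?w ^ k' * ?w' ^ k \<le> pstep s0 (k' * n) A (0, 0, j) (int k' * (int k * a), int k' * (int k * b), j)
        * pstep s0 (k * n') A (0, 0, j) (int k * (int k' * a'), int k * (int k' * b'), j)"
      by (intro mult_mono cycle_power_le) (auto simp: pstep_nonneg)
    also have "\<dots> \<le> pstep s0 (k' * n + k * n') A (0, 0, j)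
        (int k' * (int k * a) + int k * (int k' * a'), int k' * (int k * b) + int k * (int k' * b'), j)"
      by (rule cycle_mult_le)
    also have "\<dots> = ?W" by (simp add: algebra_simps)
    finally have le: "?w ^ k' * ?w' ^ k \<le> ?W" .
    have pos: "0 < ?w ^ k' * ?w' ^ k" using w w' by simp
    then have W: "0 < ?W" using le by (rule less_le_trans)
    have "ln (?w ^ k' * ?w' ^ k) \<le> ln ?W" using pos W le by (simp only: ln_le_cancel_iff)
    then have "real k' * ln ?w + real k * ln ?w' \<le> ln ?W"
      using w w' by (simp add: ln_mult ln_realpow)
    moreover have "rate j (a + a') (b + b') \<le> - ln ?W / real (k * k')"
      using k k' W by (intro rate_le j) simp_all
    moreover have "z + z' = - (real k' * ln ?w + real k * ln ?w') / real (k * k')"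
      using k k' by (simp add: zw zw' field_simps)
    ultimately show ?thesis using k k' by (smt (verit) divide_right_mono of_nat_0_le_iff)
  qed
  have "rate j (a + a') (b + b') - z' \<le> rate j a b" if "z' \<in> rates j a' b'" for z'
    unfolding rate_def[of j a b] using sum that
    by (intro cInf_greatest rates_nonempty j) (simp add: diff_le_eq)
  then have "rate j (a + a') (b + b') - rate j a b \<le> rate j a' b'"
    unfolding rate_def[of j a' b'] by (intro cInf_greatest rates_nonempty j) (simp add: algebra_simps)
  then show ?thesis by simp
qed

text \<open>One inequality repeats a cycle \<open>m\<close> times; the other reads the
  \<open>k\<close>-fold of \<open>m * (a, b)\<close> as the \<open>k * m\<close>-fold of
  \<open>(a, b)\<close>.\<close>

lemma rate_homogeneous:
  assumes j: "j < s0" and m: "0 < m"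
  shows "rate j (m * a) (m * b) = of_int m * rate j a b"
proof (rule antisym)
  obtain M where M: "m = int M" "0 < M" using m by (metis zero_less_imp_eq_int)
  have "rate j (m * a) (m * b) / real M \<le> z" if z: "z \<in> rates j a b" for z
  proof -
    obtain k n where k: "0 < k" and w: "0 < pstep s0 n A (0, 0, j) (int k * a, int k * b, j)"
      and zw: "z = - ln (pstep s0 n A (0, 0, j) (int k * a, int k * b, j)) / real k"
      using z unfolding rates_def by blast
    let ?w = "pstep s0 n A (0, 0, j) (int k * a, int k * b, j)"
    let ?W = "pstep s0 (M * n) A (0, 0, j) (int k * (m * a), int k * (m * b), j)"
    have le: "?w ^ M \<le> ?W"
      using cycle_power_le[of n j "int k * a" "int k * b" M] by (simp add: M mult_ac)
    have pos: "0 < ?w ^ M" using w by simp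
    then have W: "0 < ?W" using le by (rule less_le_trans)
    have "ln (?w ^ M) \<le> ln ?W" using pos W le by (simp only: ln_le_cancel_iff)
    then have "real M * ln ?w \<le> ln ?W" using w by (simp add: ln_realpow)
    moreover have "rate j (m * a) (m * b) \<le> - ln ?W / real k"
      using k W by (intro rate_le j)
    ultimately have "rate j (m * a) (m * b) \<le> - (real M * ln ?w) / real k"
      using k by (smt (verit) divide_right_mono of_nat_0_le_iff)
    then show ?thesis using M k by (simp add: zw field_simps)
  qed
  then have "rate j (m * a) (m * b) / real M \<le> rate j a b"
    unfolding rate_def[of j a b] by (intro cInf_greatest rates_nonempty j)
  then show "rate j (m * a) (m * b) \<le> of_int m * rate j a b"
    using M by (simp add: field_simps)
next
  obtain M where M: "m = int M" "0 < M" using m by (metis zero_less_imp_eq_int)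
  show "of_int m * rate j a b \<le> rate j (m * a) (m * b)"
    unfolding rate_def[of j "m * a"]
  proof (rule cInf_greatest[OF rates_nonempty[OF j]])
    fix z assume "z \<in> rates j (m * a) (m * b)"
    then obtain k n where k: "0 < k" and w: "0 < pstep s0 n A (0, 0, j) (int k * (m * a), int k * (m * b), j)"
      and zw: "z = - ln (pstep s0 n A (0, 0, j) (int k * (m * a), int k * (m * b), j)) / real k"
      unfolding rates_def by blast
    have eq: "int k * (m * c) = int (k * M) * c" for c by (simp add: M)
    have "rate j a b \<le> - ln (pstep s0 n A (0, 0, j) (int (k * M) * a, int (k * M) * b, j)) / real (k * M)"
      using k M w unfolding eq by (intro rate_le j) auto
    then show "of_int m * rate j a b \<le> z"
      using k M unfolding zw eq by (simp add: field_simps)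
  qed
qed

text \<open>A supporting functional \<open>\<theta>\<close> of the rate at \<open>c\<close> satisfies \<open>spr(\<theta>) \<le> 1\<close>. Moving it slightly
  towards a point of Gamma, where cycles decay geometrically, makes the inequality strict.\<close>

lemma rate_le_Sup:
  assumes j: "j < s0" and c: "0 < c1"
    and bdd: "bdd_above ((\<lambda>\<theta>. of_int c1 * fst \<theta> + of_int c2 * snd \<theta>) ` Gamma s0 A)"
  shows "rate j c1 c2 \<le> (SUP \<theta>\<in>Gamma s0 A. of_int c1 * fst \<theta> + of_int c2 * snd \<theta>)" (is "_ \<le> ?S")
proof (rule ccontr)
  assume "\<not> ?thesis"
  then have S: "?S < rate j c1 c2" by simp
  obtain t1 t2 where t: "\<And>a b. of_int a * t1 + of_int b * t2 \<le> rate j a b"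
    and tc: "of_int c1 * t1 + of_int c2 * t2 = rate j c1 c2"
    using sublinear_lattice_support[of "rate j" c1 c2, OF rate_subadditive rate_homogeneous c] j by metis
  obtain u1 u2 where u: "(u1, u2) \<in> Gamma s0 A" using Gamma_ne by auto
  obtain r where r: "0 < r" "r < 1"
    and ur: "\<And>n a b. pstep s0 n A (0, 0, j) (a, b, j) * exp (of_int a * fst (u1, u2) + of_int b * snd (u1, u2)) \<le> r ^ n"
    by (rule Gamma_cycle_bound[OF u j]) (rule that)
  define y where "y = of_int c1 * u1 + of_int c2 * u2"
  have y: "y \<le> ?S" unfolding y_def using cSUP_upper[OF u bdd] by simp
  \<comment> \<open>With this \<open>e\<close> the functional \<open>v\<close> takes at
    \<open>c\<close> the midpoint of the rate and the supremum, which is too large for a point of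
    Gamma.\<close>
  define e where "e = (rate j c1 c2 - ?S) / (2 * (rate j c1 c2 - y))"
  have e: "0 < e" "e < 1" using S y by (auto simp: e_def field_simps)
  define v where "v = ((1 - e) * t1 + e * u1, (1 - e) * t2 + e * u2)"
  have "v \<in> Gamma s0 A"
  proof (rule Gamma_if_cycle_bound[OF j])
    show "0 < exp (e * ln r)" "exp (e * ln r) < 1" using e r by (auto simp: mult_pos_neg)
    fix n a b
    let ?w = "pstep s0 n A (0, 0, j) (a, b, j)"
    show "?w * exp (of_int a * fst v + of_int b * snd v) \<le> exp (e * ln r) ^ n"
    proof (cases "0 < ?w")
      case True
      \<comment> \<open>The exponent at \<open>v\<close> is a convex combination: at most 0 from
        \<open>t\<close>, at most \<open>n * ln r\<close> from \<open>u\<close>.\<close>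
      have "of_int a * t1 + of_int b * t2 \<le> - ln ?w"
        using t[of a b] rate_le[of j 1 n a b] j True by simp
      then have T: "ln ?w + (of_int a * t1 + of_int b * t2) \<le> 0" by simp
      have "exp (ln ?w + (of_int a * u1 + of_int b * u2)) \<le> exp (real n * ln r)"
        using ur[of n a b] True r by (simp add: exp_add exp_of_nat_mult)
      then have U: "ln ?w + (of_int a * u1 + of_int b * u2) \<le> real n * ln r" by simp
      have "ln ?w + (of_int a * fst v + of_int b * snd v)
          = (1 - e) * (ln ?w + (of_int a * t1 + of_int b * t2)) + e * (ln ?w + (of_int a * u1 + of_int b * u2))"
        by (simp add: v_def algebra_simps)
      also have "\<dots> \<le> (1 - e) * 0 + e * (real n * ln r)"
        using e by (intro add_mono mult_left_mono T U) auto
      finally have "exp (ln ?w + (of_int a * fst v + of_int b * snd v)) \<le> exp (real n * (e * ln r))"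
        by (simp add: algebra_simps)
      then show ?thesis using True by (simp only: exp_add exp_of_nat_mult exp_ln)
    next
      case False
      then have "?w = 0" using pstep_nonneg[of n "(0, 0, j)" "(a, b, j)"] by linarith
      then show ?thesis by simp
    qed
  qed
  then have "of_int c1 * fst v + of_int c2 * snd v \<le> ?S" by (rule cSUP_upper[OF _ bdd])
  moreover have "of_int c1 * fst v + of_int c2 * snd v = rate j c1 c2 - e * (rate j c1 c2 - y)"
    by (simp add: v_def y_def algebra_simps tc[symmetric])
  moreover have "2 * (e * (rate j c1 c2 - y)) = rate j c1 c2 - ?S"
  proof -
    have half: "2 * (u / (2 * d) * d) = u" if "d \<noteq> 0" for u d :: real using that by simp
    have "rate j c1 c2 - y \<noteq> 0" using S y by linarith
    then show ?thesis unfolding e_def by (rule half)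
  qed
  ultimately show False using S by linarith
qed

end

text \<open>The exponent of any one cycle bounds the functional on all of Gamma.\<close>

lemma bdd_above_Gamma:
  "bdd_above ((\<lambda>\<theta>. of_int a * fst \<theta> + of_int b * snd \<theta>) ` Gamma s0 A)"
proof -
  obtain z where "z \<in> rates 0 a b" using rates_nonempty[OF s0_pos] by blast
  then show ?thesis using rates_lower_bound[OF _ s0_pos] by (intro bdd_aboveI) auto
qed

end

subsection \<open>Occupation measures of the quadrant\<close>

context qbd
begin

lemma pplus_le_geometric:
  assumes "\<theta> \<in> Gamma s0 A" "j < s0" "j' < s0"
  obtains C r where "0 < r" "r < 1" "0 < C"
    "\<And>n y1 y2. pplus s0 n A (x1, x2, j) (y1, y2, j')
      \<le> C * exp (- (of_int (y1 - x1) * fst \<theta> + of_int (y2 - x2) * snd \<theta>)) * r ^ n"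
proof -
  obtain C r where r: "0 < r" "r < 1" "0 < C"
    and C: "\<And>n i j. i < s0 \<Longrightarrow> j < s0 \<Longrightarrow> mpow s0 (tilt A \<theta>) n i j \<le> C * r ^ n"
    by (rule Gamma_geometric_bound[OF assms(1)]) (rule that)
  show thesis
  proof (rule that[OF r])
    fix n y1 y2
    let ?e = "of_int (y1 - x1) * fst \<theta> + of_int (y2 - x2) * snd \<theta>"
    have "pplus s0 n A (x1, x2, j) (y1, y2, j') * exp ?e \<le> pstep s0 n A (x1, x2, j) (y1, y2, j') * exp ?e"
      by (intro mult_right_mono pplus_le_pstep) simp
    also have "\<dots> \<le> C * r ^ n"
      using pstep_tilt_le_mpow C[OF assms(2,3)] by (rule order_trans)
    finally have "pplus s0 n A (x1, x2, j) (y1, y2, j') \<le> C * r ^ n / exp ?e"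
      by (simp only: pos_le_divide_eq exp_gt_zero)
    then show "pplus s0 n A (x1, x2, j) (y1, y2, j') \<le> C * exp (- ?e) * r ^ n"
      by (simp only: exp_minus divide_inverse mult_ac)
  qed
qed

text \<open>Convergence makes \<open>suminf\<close> in \<open>qtilde\<close> the actual expected
  number of visits.\<close>

lemma summable_pplus:
  assumes "\<theta> \<in> Gamma s0 A" "j < s0" "j' < s0"
  shows "summable (\<lambda>n. pplus s0 n A (x1, x2, j) (y1, y2, j'))"
proof -
  obtain C r where r: "0 < r" "r < 1"
    and C: "\<And>n y1 y2. pplus s0 n A (x1, x2, j) (y1, y2, j')
      \<le> C * exp (- (of_int (y1 - x1) * fst \<theta> + of_int (y2 - x2) * snd \<theta>)) * r ^ n"
    by (rule pplus_le_geometric[OF assms, of x1 x2]) (rule that)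
  show ?thesis
    by (rule summable_comparison_test'[OF summable_mult[OF summable_geometric[of r]], of 0])
      (use r C pplus_nonneg in auto)
qed

text \<open>The geometric bound is summed over \<open>n\<close>; the factor of the fixed starting
  point enters \<open>C\<close>, which is uniform in the target.\<close>

lemma qtilde_upper_bound:
  assumes "\<theta> \<in> Gamma s0 A" "j < s0" "j' < s0"
  obtains C where "0 < C"
    "\<And>y1 y2. qtilde s0 A (x1, x2, j) (y1, y2, j')
      \<le> C * exp (- (of_int y1 * fst \<theta> + of_int y2 * snd \<theta>))"
proof -
  obtain C r where r: "0 < r" "r < 1" "0 < C"
    and C: "\<And>n y1 y2. pplus s0 n A (x1, x2, j) (y1, y2, j')
      \<le> C * exp (- (of_int (y1 - x1) * fst \<theta> + of_int (y2 - x2) * snd \<theta>)) * r ^ n"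
    by (rule pplus_le_geometric[OF assms, of x1 x2]) (rule that)
  let ?D = "C * exp (of_int x1 * fst \<theta> + of_int x2 * snd \<theta>) * (1 / (1 - r))"
  show thesis
  proof (rule that[of ?D])
    show "0 < ?D" using r by simp
    fix y1 y2
    let ?c = "C * exp (- (of_int (y1 - x1) * fst \<theta> + of_int (y2 - x2) * snd \<theta>))"
    have "qtilde s0 A (x1, x2, j) (y1, y2, j') \<le> (\<Sum>n. ?c * r ^ n)"
      unfolding qtilde_def using r C
      by (intro suminf_le summable_pplus[OF assms] summable_mult summable_geometric) auto
    also have "\<dots> = ?c * (1 / (1 - r))"
      using r by (subst suminf_mult) (auto intro: summable_geometric simp: suminf_geometric)
    also have "?c = C * exp (of_int x1 * fst \<theta> + of_int x2 * snd \<theta>) * exp (- (of_int y1 * fst \<theta> + of_int y2 * snd \<theta>))"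
      by (simp add: mult.assoc exp_add[symmetric] algebra_simps)
    finally show "qtilde s0 A (x1, x2, j) (y1, y2, j') \<le> ?D * exp (- (of_int y1 * fst \<theta> + of_int y2 * snd \<theta>))"
      by (simp only: mult_ac)
  qed
qed

text \<open>A cycle of length \<open>n\<close> cannot leave the quadrant when it starts at \<open>(n, n)\<close> or further inside.\<close>

lemma pplus_cycle_power:
  assumes j: "j < s0" and c: "0 \<le> d1" "0 \<le> d2"
  shows "pstep s0 n A (0, 0, j) (d1, d2, j) ^ q
    \<le> pplus s0 (q * n) A (int n, int n, j) (int n + int q * d1, int n + int q * d2, j)"
proof (induction q)
  case 0
  then show ?case using j by (simp add: Splus_def)
next
  case (Suc q)
  let ?w = "pstep s0 n A (0, 0, j) (d1, d2, j)"
  let ?y = "\<lambda>q. (int n + int q * d1, int n + int q * d2, j)"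
  have "?w = pplus s0 n A (?y q) (?y (Suc q))"
    using j c pstep_translate_0[of s0 n A "int n + int q * d1" "int n + int q * d2" j]
    by (subst pplus_eq_pstep_if_far) (auto simp: algebra_simps)
  then have "?w ^ Suc q \<le> pplus s0 (q * n) A (int n, int n, j) (?y q) * pplus s0 n A (?y q) (?y (Suc q))"
    using Suc mult_right_mono[OF Suc pstep_nonneg[of n "(0, 0, j)" "(d1, d2, j)"]] by (simp add: mult.commute)
  also have "\<dots> \<le> pplus s0 (q * n + n) A (int n, int n, j) (?y (Suc q))" by (rule pplus_mult_le)
  finally show ?case by (simp add: add.commute)
qed

text \<open>The path goes to \<open>(n, n, j)\<close>, runs through the cycle \<open>k div m\<close>
  times and then moves to the target. Up to translation the last leg depends only on
  \<open>k mod m\<close>.\<close>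

lemma qtilde_lower_bound:
  assumes irr_plus: "Pplus_irreducible s0 A" and jj: "j < s0" "j' < s0"
    and x: "0 \<le> x1" "0 \<le> x2" and l: "0 \<le> l1" "0 \<le> l2" and m: "0 < m"
    and w: "0 < pstep s0 n A (0, 0, j) (int m * int c1, int m * int c2, j)" (is "0 < ?w")
    and summ: "\<And>y1 y2. summable (\<lambda>n. pplus s0 n A (x1, x2, j) (y1, y2, j'))"
  obtains D where "0 < D"
    "\<And>k. D * exp (real k * (ln ?w / real m))
      \<le> qtilde s0 A (x1, x2, j) (int c1 * int k + l1, int c2 * int k + l2, j')"
proof -
  have "(x1, x2, j) \<in> Splus s0" "(int n, int n, j) \<in> Splus s0"
    using jj x by (auto simp: Splus_def)
  then obtain n1 where n1: "0 < pplus s0 n1 A (x1, x2, j) (int n, int n, j)" (is "0 < ?\<alpha>")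
    using irr_plus by (auto simp: Pplus_irreducible_def)
  have "\<exists>n2. 0 < pplus s0 n2 A (int n, int n, j) (int c1 * int r + l1, int c2 * int r + l2, j')" for r
    using irr_plus jj l by (auto simp: Pplus_irreducible_def Splus_def)
  then obtain n2 where n2: "\<And>r. 0 < pplus s0 (n2 r) A (int n, int n, j) (int c1 * int r + l1, int c2 * int r + l2, j')"
    (is "\<And>r. 0 < ?\<beta> r") by metis
  define \<beta> where "\<beta> = Min (?\<beta> ` {..<m})"
  have "\<beta> \<in> ?\<beta> ` {..<m}" unfolding \<beta>_def using m by (intro Min_in) auto
  then have \<beta>: "0 < \<beta>" using n2 by auto
  show thesis
  \<comment> \<open>The factor \<open>exp (- \<bar>ln ?w\<bar>)\<close> pays for replacing
    \<open>k / m\<close> by its integer part.\<close>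
  proof (rule that[of "?\<alpha> * \<beta> * exp (- \<bar>ln ?w\<bar>)"])
    show "0 < ?\<alpha> * \<beta> * exp (- \<bar>ln ?w\<bar>)" using n1 \<beta> by simp
    fix k
    define q r where "q = k div m" and "r = k mod m"
    have k: "k = q * m + r" "r < m" using m by (auto simp: q_def r_def)
    let ?z = "(int c1 * int k + l1, int c2 * int k + l2, j')"
    let ?a = "int q * (int m * int c1)" and ?b = "int q * (int m * int c2)"
    have "\<bar>real k / real m - real q\<bar> \<le> 1" using k m by (simp add: field_simps)
    then have "\<bar>(real k / real m - real q) * ln ?w\<bar> \<le> \<bar>ln ?w\<bar>"
      by (simp add: abs_mult mult_left_le_one_le)
    then have "real k * (ln ?w / real m) - \<bar>ln ?w\<bar> \<le> real q * ln ?w"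
      by (simp add: algebra_simps abs_le_iff)
    then have "exp (real k * (ln ?w / real m) - \<bar>ln ?w\<bar>) \<le> exp (real q * ln ?w)" by simp
    then have "exp (- \<bar>ln ?w\<bar>) * exp (real k * (ln ?w / real m)) \<le> ?w ^ q"
      using w by (simp add: exp_of_nat_mult exp_add[symmetric])
    also have "\<dots> \<le> pplus s0 (q * n) A (int n, int n, j) (int n + ?a, int n + ?b, j)" (is "_ \<le> ?\<omega>")
      by (rule pplus_cycle_power[OF jj(1)]) auto
    finally have \<omega>: "exp (- \<bar>ln ?w\<bar>) * exp (real k * (ln ?w / real m)) \<le> ?\<omega>" .
    \<comment> \<open>The last leg is an inward translate of one of \<open>m\<close> fixed
      legs.\<close>
    have "?\<beta> r \<le> pplus s0 (n2 r) A (int n + ?a, int n + ?b, j) (int c1 * int r + l1 + ?a, int c2 * int r + l2 + ?b, j')"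
      by (rule pplus_translate_le) auto
    also have "\<dots> = pplus s0 (n2 r) A (int n + ?a, int n + ?b, j) ?z" (is "_ = ?\<gamma>")
      by (simp add: k(1) algebra_simps)
    finally have "?\<beta> r \<le> ?\<gamma>" .
    moreover have "\<beta> \<le> ?\<beta> r" unfolding \<beta>_def using k by (intro Min_le) auto
    ultimately have \<gamma>: "\<beta> \<le> ?\<gamma>" by linarith
    have "?\<alpha> * \<beta> * exp (- \<bar>ln ?w\<bar>) * exp (real k * (ln ?w / real m))
        = ?\<alpha> * (exp (- \<bar>ln ?w\<bar>) * exp (real k * (ln ?w / real m))) * \<beta>" by (simp only: mult_ac)
    also have "\<dots> \<le> ?\<alpha> * ?\<omega> * ?\<gamma>"
      using \<beta> n1 by (intro mult_mono \<omega> \<gamma>) (auto intro!: mult_nonneg_nonneg pplus_nonneg)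
    also have "\<dots> \<le> pplus s0 (n1 + q * n) A (x1, x2, j) (int n + ?a, int n + ?b, j) * ?\<gamma>"
      by (intro mult_right_mono pplus_mult_le pplus_nonneg)
    also have "\<dots> \<le> pplus s0 (n1 + q * n + n2 r) A (x1, x2, j) ?z" by (rule pplus_mult_le)
    also have "\<dots> \<le> qtilde s0 A (x1, x2, j) ?z"
      unfolding qtilde_def using sum_le_suminf[OF summ, of "{n1 + q * n + n2 r}"] pplus_nonneg by simp
    finally show "?\<alpha> * \<beta> * exp (- \<bar>ln ?w\<bar>) * exp (real k * (ln ?w / real m)) \<le> qtilde s0 A (x1, x2, j) ?z" .
  qed
qed

end

section \<open>The limit from the upper and lower bounds\<close>

theorem theorem5p1:
  fixes s0 :: nat and A :: "int \<Rightarrow> int \<Rightarrow> nat \<Rightarrow> nat \<Rightarrow> real"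
    and c1 c2 :: nat and x1 x2 l1 l2 :: int and j j' :: nat
  assumes blocks: "qbd_blocks s0 A"
    and irr: "chain_irreducible s0 A" and aper: "chain_aperiodic s0 A"
    and drift: "\<exists>p. stationary s0 A p \<and> (drift1 s0 A p < 0 \<or> drift2 s0 A p < 0)"
    and irr_plus: "Pplus_irreducible s0 A"
    and c_pos: "c1 > 0" "c2 > 0"
    and x_nonneg: "x1 \<ge> 0" "x2 \<ge> 0" and x_bd: "x1 = 0 \<or> x2 = 0"
    and l_nonneg: "l1 \<ge> 0" "l2 \<ge> 0" and l_bd: "l1 = 0 \<or> l2 = 0"
    and jj: "j < s0" "j' < s0"
  shows "(\<lambda>k. ln (qtilde s0 A (x1, x2, j) (int c1 * int k + l1, int c2 * int k + l2, j')) / real k)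
           \<longlonglongrightarrow> - (SUP \<theta>\<in>Gamma s0 A. real c1 * fst \<theta> + real c2 * snd \<theta>)"
proof -
  interpret irreducible_qbd s0 A by standard (fact blocks irr)+
  let ?q = "\<lambda>k. qtilde s0 A (x1, x2, j) (int c1 * int k + l1, int c2 * int k + l2, j')"
  let ?S = "SUP \<theta>\<in>Gamma s0 A. real c1 * fst \<theta> + real c2 * snd \<theta>"
  have ne: "Gamma s0 A \<noteq> {}" using drift Gamma_nonempty by blast
  have bdd: "bdd_above ((\<lambda>\<theta>. real c1 * fst \<theta> + real c2 * snd \<theta>) ` Gamma s0 A)"
    using bdd_above_Gamma[of "int c1" "int c2"] by simp
  have summ: "summable (\<lambda>n. pplus s0 n A (x1, x2, j) (y1, y2, j'))" for y1 y2
    using ne summable_pplus[OF _ jj] by blast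
  have below: "\<exists>E R. R > a \<and> (\<forall>k>0. 0 < ?q k \<and> E / real k + R \<le> ln (?q k) / real k)" if a: "a < - ?S" for a
  proof -
    have "rate j (int c1) (int c2) \<le> ?S"
      using rate_le_Sup[OF ne jj(1), of "int c1" "int c2"] bdd c_pos by simp
    \<comment> \<open>An infimum below \<open>- a\<close> supplies one cycle whose exponent is
      already good enough.\<close>
    then have "Inf (rates j (int c1) (int c2)) < - a" using a by (simp add: rate_def)
    then obtain z where z: "z \<in> rates j (int c1) (int c2)" "z < - a"
      using cInf_lessD[OF rates_nonempty[OF jj(1)]] by blast
    then obtain m n where m: "0 < m" and w: "0 < pstep s0 n A (0, 0, j) (int m * int c1, int m * int c2, j)" (is "0 < ?w")
      and zw: "z = - ln (pstep s0 n A (0, 0, j) (int m * int c1, int m * int c2, j)) / real m"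
      unfolding rates_def by blast
    obtain D where D: "0 < D" and low: "\<And>k. D * exp (real k * (ln ?w / real m)) \<le> ?q k"
      by (rule qtilde_lower_bound[OF irr_plus jj x_nonneg l_nonneg m w summ]) (rule that)
    have "0 < ?q k \<and> ln D / real k + ln ?w / real m \<le> ln (?q k) / real k" if k: "0 < k" for k
    proof
      have pos: "0 < D * exp (real k * (ln ?w / real m))" using D by simp
      then show q: "0 < ?q k" using low[of k] by (rule less_le_trans)
      have "ln D + real k * (ln ?w / real m) = ln (D * exp (real k * (ln ?w / real m)))"
        using D by (simp add: ln_mult)
      also have "\<dots> \<le> ln (?q k)" using low[of k] pos q by (simp only: ln_le_cancel_iff)
      finally have "(ln D + real k * (ln ?w / real m)) / real k \<le> ln (?q k) / real k"
        by (rule divide_right_mono) simp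
      then show "ln D / real k + ln ?w / real m \<le> ln (?q k) / real k"
        using k by (simp add: add_divide_distrib)
    qed
    moreover have "a < ln ?w / real m" using z(2) by (simp add: zw)
    ultimately show ?thesis by blast
  qed
  \<comment> \<open>Positivity, from the lower bound at an arbitrary level, justifies taking
    logarithms in the upper bound.\<close>
  have q_pos: "0 < ?q k" if "0 < k" for k
    using below[of "- ?S - 1"] that by auto
  have above: "\<exists>E R. R < a \<and> (\<forall>k>0. ln (?q k) / real k \<le> E / real k + R)" if a: "- ?S < a" for a
  proof -
    obtain \<theta> where th: "\<theta> \<in> Gamma s0 A" and gt: "- a < real c1 * fst \<theta> + real c2 * snd \<theta>"
      using less_cSUP_iff[OF ne bdd, of "- a"] a by auto
    let ?R = "real c1 * fst \<theta> + real c2 * snd \<theta>" and ?L = "of_int l1 * fst \<theta> + of_int l2 * snd \<theta>"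
    obtain C where C: "0 < C" and up: "\<And>y1 y2. qtilde s0 A (x1, x2, j) (y1, y2, j')
        \<le> C * exp (- (of_int y1 * fst \<theta> + of_int y2 * snd \<theta>))"
      by (rule qtilde_upper_bound[OF th jj, of x1 x2]) (rule that)
    have "ln (?q k) / real k \<le> (ln C - ?L) / real k + - ?R" if k: "0 < k" for k
    proof -
      have "?q k \<le> C * exp (- ?L - real k * ?R)"
        using up[of "int c1 * int k + l1" "int c2 * int k + l2"] by (simp add: algebra_simps)
      then have "ln (?q k) \<le> ln (C * exp (- ?L - real k * ?R))"
        using q_pos[OF k] C by simp
      also have "\<dots> = ln C - ?L - real k * ?R" using C by (simp add: ln_mult)
      finally have "ln (?q k) / real k \<le> (ln C - ?L - real k * ?R) / real k"
        by (rule divide_right_mono) simp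
      also have "\<dots> = (ln C - ?L) / real k + - ?R"
        using k by (simp only: diff_divide_distrib) simp
      finally show ?thesis .
    qed
    then show ?thesis using gt by (intro exI[of _ "ln C - ?L"] exI[of _ "- ?R"]) auto
  qed
  \<comment> \<open>The multiplicative constants of both bounds contribute only
    \<open>E / k\<close>.\<close>
  have lim: "(\<lambda>k. E / real k + R) \<longlonglongrightarrow> R" for E R
    using tendsto_add[OF lim_const_over_n[of E] tendsto_const[of R]] by simp
  show ?thesis
  proof (rule order_tendstoI)
    fix a assume "a < - ?S"
    then obtain E R where R: "a < R" "\<And>k. 0 < k \<Longrightarrow> E / real k + R \<le> ln (?q k) / real k"
      using below by blast
    show "eventually (\<lambda>k. a < ln (?q k) / real k) sequentially"
      using order_tendstoD(1)[OF lim R(1), of E] eventually_gt_at_top[of 0]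
      by eventually_elim (use R(2) in \<open>auto intro: less_le_trans\<close>)
  next
    fix a assume "- ?S < a"
    then obtain E R where R: "R < a" "\<And>k. 0 < k \<Longrightarrow> ln (?q k) / real k \<le> E / real k + R"
      using above by blast
    show "eventually (\<lambda>k. ln (?q k) / real k < a) sequentially"
      using order_tendstoD(2)[OF lim R(1), of E] eventually_gt_at_top[of 0]
      by eventually_elim (use R(2) in \<open>auto intro: le_less_trans\<close>)
  qed
qed

end
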